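(* The orders of the rotations generated by pairs of simple reflections of the root systems $I_2(n)$, $A_1\times I_2(n)$, $A_3$, $B_3$, $H_3$ are exactly the leg lengths of the $ADE$ Dynkin diagrams $A_n$, $D_{n+2}$, $E_6$, $E_7$, $E_8$, respectively. That is: (i) for every integer $n\ge 2$, the product of the two simple reflections of $I_2(n)$ has order $n$, and the diagram consisting of a single leg (a simple string) of $n$ nodes is the Dynkin diagram $A_n$; (ii) for $\Phi=A_1\times I_2(n)$ (with $n\ge2$), $A_3$, $B_3$, $H_3$, with simple reflections $s_1,s_2,s_3$, the multiset of orders of the three products $s_1s_2$, $s_1s_3$, $s_2s_3$ is $\{2,2,n\}$, $\{2,3,3\}$, $\{2,3,4\}$, $\{2,3,5\}$, respectively, and the corresponding diagrams $T_{2,2,n}$, $T_{2,3,3}$, $T_{2,3,4}$, $T_{2,3,5}$ are the Dynkin diagrams $D_{n+2}$, $E_6$, $E_7$, $E_8$, respectively.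
   Context: $I_2(n)$ is the planar root system whose reflection group is the symmetry group of the regular $n$-gon (dihedral of order $2n$), with simple roots $e_1$ and $-\cos\frac{\pi}{n}e_1+\sin\frac{\pi}{n}e_2$. $A_1\times I_2(n)$ is the three-dimensional root system that is the orthogonal union of $A_1=\{\pm e\}$ ($e$ a unit vector) and $I_2(n)$; its simple roots are $e$ together with the two simple roots of $I_2(n)$. $A_3, B_3, H_3$ are the irreducible three-dimensional root systems with full tetrahedral, octahedral and icosahedral reflection symmetry, respectively. The simple reflections are the orthogonal reflections in the hyperplanes normal to the simple roots. For integers $p,q,r\ge 2$, $T_{p,q,r}$ denotes the simply-laced diagram (tree) consisting of three legs, which are strings of $p$, $q$ and $r$ nodes, glued at a common end node (the central node). The central node is counted in the length of each leg, so $T_{p,q,r}$ has $p+q+r-2$ nodes. *)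

theory Defs
  imports
    "HOL-Analysis.Analysis"
    "HOL-Algebra.Bij"
    "HOL-Algebra.Generated_Groups"
    "HOL-Algebra.Multiplicative_Group"
    "HOL-Library.Multiset"
    "Graph_Theory.Digraph_Isomorphism"
    "Graph_Theory.Pair_Digraph"
begin

section \<open>Root systems and their reflections\<close>

definition reflection :: "'a::real_inner \<Rightarrow> 'a \<Rightarrow> 'a" where
  "reflection \<alpha> x = x - (2 * (x \<bullet> \<alpha>) / (\<alpha> \<bullet> \<alpha>)) *\<^sub>R \<alpha>"

text \<open>Root systems in the sense of reflection groups: no crystallographic condition is imposed
  and the lengths of the roots are immaterial.\<close>

definition root_system :: "'a::euclidean_space set \<Rightarrow> bool" where
  "root_system \<Phi> \<longleftrightarrow>
     finite \<Phi> \<and> 0 \<notin> \<Phi> \<and> span \<Phi> = UNIV \<and>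
     (\<forall>\<alpha>\<in>\<Phi>. \<Phi> \<inter> span {\<alpha>} = {\<alpha>, - \<alpha>}) \<and>
     (\<forall>\<alpha>\<in>\<Phi>. reflection \<alpha> ` \<Phi> = \<Phi>)"

definition irreducible_roots :: "'a::euclidean_space set \<Rightarrow> bool" where
  "irreducible_roots \<Phi> \<longleftrightarrow>
     \<not> (\<exists>\<Phi>1 \<Phi>2. \<Phi>1 \<noteq> {} \<and> \<Phi>2 \<noteq> {} \<and> \<Phi> = \<Phi>1 \<union> \<Phi>2 \<and> (\<forall>\<alpha>\<in>\<Phi>1. \<forall>\<beta>\<in>\<Phi>2. \<alpha> \<bullet> \<beta> = 0))"

definition simple_roots :: "'a::euclidean_space set \<Rightarrow> 'a list \<Rightarrow> bool" where
  "simple_roots \<Phi> \<Delta> \<longleftrightarrow>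
     distinct \<Delta> \<and> set \<Delta> \<subseteq> \<Phi> \<and> independent (set \<Delta>) \<and>
     (\<forall>\<beta>\<in>\<Phi>. \<exists>c. \<beta> = (\<Sum>\<alpha>\<in>set \<Delta>. c \<alpha> *\<^sub>R \<alpha>) \<and>
        ((\<forall>\<alpha>\<in>set \<Delta>. 0 \<le> c \<alpha>) \<or> (\<forall>\<alpha>\<in>set \<Delta>. c \<alpha> \<le> 0)))"

definition reflection_group :: "'a::euclidean_space set \<Rightarrow> ('a \<Rightarrow> 'a) set" where
  "reflection_group \<Phi> = generate (BijGroup UNIV) (reflection ` \<Phi>)"

definition symmetry_group :: "'a::euclidean_space set \<Rightarrow> ('a \<Rightarrow> 'a) set" where
  "symmetry_group V = {f. orthogonal_transformation f \<and> f ` V = V}"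

definition rotation_order :: "'a::euclidean_space \<Rightarrow> 'a \<Rightarrow> nat" where
  "rotation_order \<alpha> \<beta> = group.ord (BijGroup UNIV) (reflection \<alpha> \<circ> reflection \<beta>)"

definition rotation_orders :: "'a::euclidean_space \<Rightarrow> 'a \<Rightarrow> 'a \<Rightarrow> nat multiset" where
  "rotation_orders \<alpha> \<beta> \<gamma> = {# rotation_order \<alpha> \<beta>, rotation_order \<alpha> \<gamma>, rotation_order \<beta> \<gamma> #}"


section \<open>The root systems \<open>I\<^sub>2(n)\<close> and \<open>A\<^sub>1 \<times> I\<^sub>2(n)\<close>\<close>

definition I2_roots :: "nat \<Rightarrow> (real^2) set" where
  "I2_roots n = (\<lambda>k::int. vector [cos (k * pi / n), sin (k * pi / n)]) ` UNIV"

definition I2_simple1 :: "real^2" where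
  "I2_simple1 = axis 1 1"

definition I2_simple2 :: "nat \<Rightarrow> real^2" where
  "I2_simple2 n = - cos (pi / n) *\<^sub>R axis 1 1 + sin (pi / n) *\<^sub>R axis 2 1"

definition regular_polygon :: "nat \<Rightarrow> (real^2) set" where
  "regular_polygon n = (\<lambda>k::int. vector [- sin (2 * k * pi / n), cos (2 * k * pi / n)]) ` UNIV"

definition A1_roots :: "real set" where
  "A1_roots = {1, - 1}"

definition orthogonal_union :: "'a::euclidean_space set \<Rightarrow> 'b::euclidean_space set \<Rightarrow> ('a \<times> 'b) set" where
  "orthogonal_union \<Phi> \<Psi> = (\<lambda>\<alpha>. (\<alpha>, 0)) ` \<Phi> \<union> (\<lambda>\<beta>. (0, \<beta>)) ` \<Psi>"


text \<open>The vectors \<open>I2_simple1\<close>, \<open>I2_simple2 n\<close> are simple roots of the root system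
  \<open>I2_roots n\<close>, whose reflection group is the symmetry group of the regular \<open>n\<close>-gon, and together
  with the unit vector \<open>(1, 0)\<close> they are simple roots of the orthogonal union.\<close>

lemma vector2_eq_iff: "(x::real^2) = y \<longleftrightarrow> x $ 1 = y $ 1 \<and> x $ 2 = y $ 2"
  by (simp add: vec_eq_iff forall_2)

lemma inner_real2: "(x::real^2) \<bullet> y = x $ 1 * y $ 1 + x $ 2 * y $ 2"
  by (simp add: inner_vec_def sum_2)

lemma reflection_circle:
  "reflection (vector [cos a, sin a]) (vector [r * cos b, r * sin b] :: real^2)
     = vector [r * cos (2 * a + pi - b), r * sin (2 * a + pi - b)]"
proof -
  have n: "(vector [cos a, sin a] :: real^2) \<bullet> vector [cos a, sin a] = 1"
    by (simp add: inner_real2 flip: power2_eq_square)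
  have c: "cos (2 * a + pi - b) = cos b - 2 * cos (b - a) * cos a"
  proof -
    have "cos (2 * a + pi - b) = - cos ((a + (a - b)))"
      by (metis add.commute add_diff_eq cos_periodic_pi2 mult_2 add.assoc)
    also have "\<dots> = - (cos a * cos (a - b) - sin a * sin (a - b))" by (simp only: cos_add)
    also have "\<dots> = cos a * cos (a - b) + sin a * sin (a - b) - 2 * cos (a - b) * cos a" by simp
    also have "cos a * cos (a - b) + sin a * sin (a - b) = cos (a - (a - b))" by (simp only: cos_diff)
    finally show ?thesis by (simp add: cos_diff mult.commute)
  qed
  have s: "sin (2 * a + pi - b) = sin b - 2 * cos (b - a) * sin a"
  proof -
    have "sin (2 * a + pi - b) = - sin ((a + (a - b)))"
      by (metis add.commute add_diff_eq sin_periodic_pi2 mult_2 add.assoc)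
    also have "\<dots> = - (sin a * cos (a - b) + cos a * sin (a - b))" by (simp only: sin_add)
    also have "\<dots> = sin a * cos (a - b) - cos a * sin (a - b) - 2 * cos (a - b) * sin a" by simp
    also have "sin a * cos (a - b) - cos a * sin (a - b) = sin (a - (a - b))" by (simp only: sin_diff)
    finally show ?thesis by (simp add: cos_diff mult.commute)
  qed
  have i: "(vector [r * cos b, r * sin b] :: real^2) \<bullet> vector [cos a, sin a] = r * cos (b - a)"
    by (simp add: inner_real2 cos_diff algebra_simps)
  show ?thesis
    unfolding reflection_def n i c s by (simp add: vector2_eq_iff algebra_simps)
qed

lemma reflection_I2:
  assumes "n > 0"
  shows "reflection (vector [cos (of_int j * pi / real n), sin (of_int j * pi / real n)])
      (vector [cos (of_int k * pi / real n), sin (of_int k * pi / real n)] :: real^2)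
     = vector [cos (of_int (2 * j + int n - k) * pi / real n), sin (of_int (2 * j + int n - k) * pi / real n)]"
proof -
  have "of_int (2 * j + int n - k) * pi / real n
      = 2 * (of_int j * pi / real n) + pi - of_int k * pi / real n"
    using assms by (simp add: field_simps)
  then show ?thesis using reflection_circle[of _ 1] by simp
qed

lemma I2_root_in: "vector [cos (of_int k * pi / real n), sin (of_int k * pi / real n)] \<in> I2_roots n"
  unfolding I2_roots_def by blast

lemma I2_rootE:
  assumes "\<beta> \<in> I2_roots n" "n > 0"
  obtains k :: int where "0 \<le> k" "k < 2 * int n"
    "\<beta> = vector [cos (of_int k * pi / real n), sin (of_int k * pi / real n)]"
proof -
  obtain k :: int where k: "\<beta> = vector [cos (of_int k * pi / real n), sin (of_int k * pi / real n)]"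
    using assms unfolding I2_roots_def by blast
  define m where "m = k mod (2 * int n)"
  define q where "q = k div (2 * int n)"
  have "k = m + 2 * int n * q" unfolding m_def q_def by simp
  then have "of_int k * pi / real n = of_int m * pi / real n + 2 * pi * of_int q"
    using assms(2) by (simp add: field_simps)
  then have "cos (of_int k * pi / real n) = cos (of_int m * pi / real n)"
    "sin (of_int k * pi / real n) = sin (of_int m * pi / real n)"
    by (simp_all add: cos_add sin_add)
  moreover have "0 \<le> m" "m < 2 * int n" using assms(2) unfolding m_def by simp_all
  ultimately show thesis using that[of m] k by simp
qed

lemma I2_simple1_alt: "I2_simple1 = vector [cos (of_int 0 * pi / real n), sin (of_int 0 * pi / real n)]"
  by (simp add: I2_simple1_def vector2_eq_iff axis_def)

lemma I2_simple2_alt: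
  assumes "n > 0"
  shows "I2_simple2 n = vector [cos (of_int (int n - 1) * pi / real n), sin (of_int (int n - 1) * pi / real n)]"
proof -
  have "of_int (int n - 1) * pi / real n = pi - pi / real n" using assms by (simp add: field_simps)
  then show ?thesis by (simp add: I2_simple2_def vector2_eq_iff axis_def)
qed

lemma I2_sin_pos: "n \<ge> 2 \<Longrightarrow> sin (pi / real n) > 0"
  by (rule sin_gt_zero) (simp_all add: field_simps)

lemma I2_combination:
  assumes "n \<ge> 2"
  shows "(vector [cos t, sin t] :: real^2)
    = (sin (t + pi / real n) / sin (pi / real n)) *\<^sub>R I2_simple1 + (sin t / sin (pi / real n)) *\<^sub>R I2_simple2 n"
  using I2_sin_pos[OF assms]
  by (simp add: I2_simple1_def I2_simple2_def vector2_eq_iff axis_def sin_add field_simps)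

lemma I2_simple_distinct:
  assumes "n \<ge> 2"
  shows "I2_simple1 \<noteq> I2_simple2 n"
  using I2_sin_pos[OF assms] by (simp add: I2_simple1_def I2_simple2_def vector2_eq_iff axis_def)

lemma I2_simple_independent:
  assumes "n \<ge> 2"
  shows "independent {I2_simple1, I2_simple2 n}"
proof -
  have "I2_simple2 n \<noteq> c *\<^sub>R I2_simple1" for c
    using I2_sin_pos[OF assms] by (simp add: I2_simple1_def I2_simple2_def vector2_eq_iff axis_def)
  moreover have "I2_simple1 \<noteq> 0" by (simp add: I2_simple1_def)
  ultimately have "I2_simple2 n \<notin> span {I2_simple1}" by (auto simp: span_singleton)
  moreover have "independent {I2_simple1}" using \<open>I2_simple1 \<noteq> 0\<close> by simp
  ultimately have "independent (insert (I2_simple2 n) {I2_simple1})"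
    by (rule independent_insertI)
  then show ?thesis by (simp add: insert_commute)
qed

theorem I2_root_system:
  assumes "n \<ge> 2"
  shows "root_system (I2_roots n)"
  unfolding root_system_def
proof (intro conjI ballI)
  have n0: "n > 0" using assms by simp
  have "I2_roots n \<subseteq> (\<lambda>k::int. vector [cos (k * pi / real n), sin (k * pi / real n)]) ` {0..<2 * int n}"
    by (auto elim!: I2_rootE[OF _ n0])
  then show "finite (I2_roots n)" by (rule finite_subset) simp
  have unit: "\<beta> \<bullet> \<beta> = 1" if "\<beta> \<in> I2_roots n" for \<beta>
    using that by (auto simp: I2_roots_def inner_real2 simp flip: power2_eq_square)
  show "0 \<notin> I2_roots n" using unit by force
  have simple: "{I2_simple1, I2_simple2 n} \<subseteq> I2_roots n"
    using I2_root_in[of 0 n] I2_root_in[of "int n - 1" n] I2_simple1_alt[of n] I2_simple2_alt[OF n0]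
    by simp
  have "dim {I2_simple1, I2_simple2 n} = 2"
    using dim_eq_card_independent[OF I2_simple_independent[OF assms]] I2_simple_distinct[OF assms] by simp
  then have "span {I2_simple1, I2_simple2 n} = UNIV"
    by (simp add: dim_eq_full[symmetric])
  then show "span (I2_roots n) = UNIV" using span_mono[OF simple] by auto
  fix \<alpha> assume \<alpha>: "\<alpha> \<in> I2_roots n"
  then obtain j :: int where j: "\<alpha> = vector [cos (of_int j * pi / real n), sin (of_int j * pi / real n)]"
    unfolding I2_roots_def by blast
  have "of_int (j + int n) * pi / real n = of_int j * pi / real n + pi"
    using n0 by (simp add: field_simps)
  then have "- \<alpha> = vector [cos (of_int (j + int n) * pi / real n), sin (of_int (j + int n) * pi / real n)]"
    by (simp add: j vector2_eq_iff)
  then have neg: "- \<alpha> \<in> I2_roots n" using I2_root_in[of "j + int n" n] by simp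
  show "I2_roots n \<inter> span {\<alpha>} = {\<alpha>, - \<alpha>}"
  proof
    show "{\<alpha>, - \<alpha>} \<subseteq> I2_roots n \<inter> span {\<alpha>}" using \<alpha> neg by (auto simp: span_base span_neg)
    show "I2_roots n \<inter> span {\<alpha>} \<subseteq> {\<alpha>, - \<alpha>}"
    proof
      fix \<beta> assume \<beta>: "\<beta> \<in> I2_roots n \<inter> span {\<alpha>}"
      then obtain c where c: "\<beta> = c *\<^sub>R \<alpha>" by (auto simp: span_singleton)
      have "c * c = 1" using unit[of \<beta>] unit[OF \<alpha>] \<beta> c by simp
      then have "c = 1 \<or> c = -1" by (simp add: square_eq_1_iff)
      then show "\<beta> \<in> {\<alpha>, - \<alpha>}" using c by auto
    qed
  qed
  have sub: "reflection \<alpha> \<beta> \<in> I2_roots n" if \<beta>: "\<beta> \<in> I2_roots n" for \<beta>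
  proof -
    obtain k :: int where k: "\<beta> = vector [cos (of_int k * pi / real n), sin (of_int k * pi / real n)]"
      using \<beta> unfolding I2_roots_def by blast
    show ?thesis unfolding j k reflection_I2[OF n0] by (rule I2_root_in)
  qed
  have invol: "reflection \<alpha> (reflection \<alpha> \<beta>) = \<beta>" for \<beta>
    using unit[OF \<alpha>] by (simp add: reflection_def inner_diff_left)
  show "reflection \<alpha> ` I2_roots n = I2_roots n"
    using sub invol by (metis image_iff subset_antisym subsetI)
qed

theorem I2_simple_roots:
  assumes "n \<ge> 2"
  shows "simple_roots (I2_roots n) [I2_simple1, I2_simple2 n]"
  unfolding simple_roots_def
proof (intro conjI ballI)
  have n0: "n > 0" using assms by simp
  show "distinct [I2_simple1, I2_simple2 n]" using I2_simple_distinct[OF assms] by simp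
  show "set [I2_simple1, I2_simple2 n] \<subseteq> I2_roots n"
    using I2_root_in[of 0 n] I2_root_in[of "int n - 1" n] I2_simple1_alt[of n] I2_simple2_alt[OF n0]
    by simp
  show "independent (set [I2_simple1, I2_simple2 n])" using I2_simple_independent[OF assms] by simp
  fix \<beta> assume "\<beta> \<in> I2_roots n"
  then obtain k :: int where k: "0 \<le> k" "k < 2 * int n"
    and \<beta>: "\<beta> = vector [cos (of_int k * pi / real n), sin (of_int k * pi / real n)]"
    by (rule I2_rootE[OF _ n0])
  define t where "t = of_int k * pi / real n"
  define c where "c = (\<lambda>v. if v = I2_simple1 then sin (t + pi / real n) / sin (pi / real n)
                           else sin t / sin (pi / real n))"
  have t': "t + pi / real n = of_int (k + 1) * pi / real n" by (simp add: t_def add_divide_distrib algebra_simps)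
  have "\<beta> = (\<Sum>\<alpha>\<in>set [I2_simple1, I2_simple2 n]. c \<alpha> *\<^sub>R \<alpha>)"
    using I2_combination[OF assms, of t] I2_simple_distinct[OF assms] by (simp add: \<beta> t_def c_def)
  moreover have "(\<forall>\<alpha>\<in>set [I2_simple1, I2_simple2 n]. 0 \<le> c \<alpha>) \<or> (\<forall>\<alpha>\<in>set [I2_simple1, I2_simple2 n]. c \<alpha> \<le> 0)"
  proof (cases "k < int n")
    case True
    have "0 \<le> sin (of_int m * pi / real n)" if "0 \<le> m" "m \<le> int n" for m
    proof (rule sin_ge_zero)
      show "0 \<le> of_int m * pi / real n" using that by simp
      have "real_of_int m \<le> real n" using that by linarith
      then show "of_int m * pi / real n \<le> pi" using n0 by (simp add: field_simps)
    qed
    from this[of k] this[of "k + 1"] have "0 \<le> sin t" "0 \<le> sin (t + pi / real n)"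
      unfolding t' using k True by (simp_all add: t_def)
    then show ?thesis using I2_sin_pos[OF assms] by (simp add: c_def)
  next
    case False
    have "sin (of_int m * pi / real n) \<le> 0" if "int n \<le> m" "m \<le> 2 * int n" for m
    proof -
      have "real n \<le> real_of_int m" "real_of_int m \<le> 2 * real n" using that by linarith+
      then have "pi \<le> of_int m * pi / real n" "of_int m * pi / real n \<le> 2 * pi"
        using n0 by (simp_all add: field_simps)
      then show ?thesis using sin_ge_zero[of "of_int m * pi / real n - pi"] by (simp add: sin_diff)
    qed
    from this[of k] this[of "k + 1"] have "sin t \<le> 0" "sin (t + pi / real n) \<le> 0"
      unfolding t' using k False by (simp_all add: t_def)
    then show ?thesis using I2_sin_pos[OF assms] by (simp add: c_def divide_nonpos_pos)
  qed
  ultimately show "\<exists>c. \<beta> = (\<Sum>\<alpha>\<in>set [I2_simple1, I2_simple2 n]. c \<alpha> *\<^sub>R \<alpha>) \<and>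
    ((\<forall>\<alpha>\<in>set [I2_simple1, I2_simple2 n]. 0 \<le> c \<alpha>) \<or> (\<forall>\<alpha>\<in>set [I2_simple1, I2_simple2 n]. c \<alpha> \<le> 0))"
    by blast
qed

lemma reflection_inner:
  "\<alpha> \<noteq> 0 \<Longrightarrow> reflection \<alpha> x \<bullet> reflection \<alpha> y = x \<bullet> y"
  by (simp add: reflection_def inner_diff_left inner_diff_right inner_commute field_simps)

lemma orthogonal_transformation_reflection:
  assumes "\<alpha> \<noteq> 0"
  shows "orthogonal_transformation (reflection \<alpha>)"
proof -
  have "linear (reflection \<alpha>)"
    by (rule linearI)
       (simp_all add: reflection_def inner_add_left distrib_left add_divide_distrib scaleR_add_left scaleR_diff_right)
  then show ?thesis using reflection_inner[OF assms] by (simp add: orthogonal_transformation_def)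
qed

lemma reflection_reflection: "reflection \<alpha> (reflection \<alpha> x) = x"
  by (cases "\<alpha> = 0") (simp_all add: reflection_def inner_diff_left)

lemma mult_BijGroup: "bij f \<Longrightarrow> bij g \<Longrightarrow> f \<otimes>\<^bsub>BijGroup UNIV\<^esub> g = f \<circ> g"
  by (simp add: BijGroup_def Bij_def compose_def fun_eq_iff restrict_def)

lemma one_BijGroup: "\<one>\<^bsub>BijGroup UNIV\<^esub> = id"
  by (simp add: BijGroup_def fun_eq_iff restrict_def)

lemma reflection_bij: "bij (reflection \<alpha>)"
  by (rule o_bij[of "reflection \<alpha>"]) (simp_all add: fun_eq_iff reflection_reflection)

lemma inv_reflection_BijGroup: "inv\<^bsub>BijGroup UNIV\<^esub> (reflection \<alpha>) = reflection \<alpha>"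
proof -
  interpret group "BijGroup (UNIV :: 'a set)" by (rule group_BijGroup)
  have "reflection \<alpha> \<in> carrier (BijGroup UNIV)" by (simp add: BijGroup_def Bij_def reflection_bij)
  moreover have "reflection \<alpha> \<otimes>\<^bsub>BijGroup UNIV\<^esub> reflection \<alpha> = \<one>\<^bsub>BijGroup UNIV\<^esub>"
    by (simp add: mult_BijGroup reflection_bij one_BijGroup fun_eq_iff reflection_reflection)
  ultimately show ?thesis by (simp add: inv_equality)
qed

lemma regular_polygon_alt:
  "regular_polygon n =
     (\<lambda>k::int. vector [1 * cos (of_int (2 * k) * pi / real n + pi / 2), 1 * sin (of_int (2 * k) * pi / real n + pi / 2)]) ` UNIV"
  by (simp add: regular_polygon_def cos_add sin_add)

theorem I2_reflection_group:
  assumes "n \<ge> 2"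
  shows "reflection_group (I2_roots n) = symmetry_group (regular_polygon n)"
proof
  have n0: "n > 0" using assms by simp
  let ?G = "BijGroup (UNIV :: (real^2) set)"
  let ?r = "\<lambda>j::int. vector [cos (of_int j * pi / real n), sin (of_int j * pi / real n)] :: real^2"
  let ?v = "\<lambda>k::int. vector [1 * cos (of_int (2 * k) * pi / real n + pi / 2), 1 * sin (of_int (2 * k) * pi / real n + pi / 2)] :: real^2"
  have nz: "\<alpha> \<noteq> 0" if "\<alpha> \<in> I2_roots n" for \<alpha>
    using I2_root_system[OF assms] that by (auto simp: root_system_def)
  have rv: "reflection (?r j) (?v k) = ?v (j - k)" for j k
  proof -
    have "2 * (of_int j * pi / real n) + pi - (of_int (2 * k) * pi / real n + pi / 2)
        = of_int (2 * (j - k)) * pi / real n + pi / 2"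
      using n0 by (simp add: field_simps)
    then show ?thesis by (simp only: reflection_circle)
  qed
  have refl: "reflection \<alpha> \<in> symmetry_group (regular_polygon n)" if "\<alpha> \<in> I2_roots n" for \<alpha>
  proof -
    obtain j where j: "\<alpha> = ?r j" using \<open>\<alpha> \<in> I2_roots n\<close> unfolding I2_roots_def by blast
    have "reflection \<alpha> ` regular_polygon n \<subseteq> regular_polygon n"
    proof (rule image_subsetI)
      fix v assume "v \<in> regular_polygon n"
      then obtain k where "v = ?v k" unfolding regular_polygon_alt by blast
      then have "reflection \<alpha> v = ?v (j - k)" using rv[of j k] by (simp only: j)
      then show "reflection \<alpha> v \<in> regular_polygon n" unfolding regular_polygon_alt by blast
    qed
    moreover from this have "regular_polygon n \<subseteq> reflection \<alpha> ` regular_polygon n"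
      by (metis image_eqI image_subset_iff reflection_reflection subsetI)
    ultimately show ?thesis
      using orthogonal_transformation_reflection[OF nz[OF that]] by (auto simp: symmetry_group_def)
  qed
  have bij: "bij f" if "f \<in> symmetry_group (regular_polygon n)" for f
    using that by (auto simp: symmetry_group_def orthogonal_transformation_bij)
  show "reflection_group (I2_roots n) \<subseteq> symmetry_group (regular_polygon n)"
  proof
    fix f assume "f \<in> reflection_group (I2_roots n)"
    then show "f \<in> symmetry_group (regular_polygon n)"
      unfolding reflection_group_def
    proof (induction rule: generate.induct)
      case one
      then show ?case by (simp add: one_BijGroup symmetry_group_def orthogonal_transformation_def linear_id[unfolded id_def])
    next
      case (incl h)
      then show ?case using refl by auto
    next
      case (inv h)
      then show ?case using refl by (auto simp: inv_reflection_BijGroup)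
    next
      case (eng h1 h2)
      have "orthogonal_transformation (h1 \<circ> h2)"
        using eng.IH by (auto simp: symmetry_group_def intro: orthogonal_transformation_compose)
      moreover have "(h1 \<circ> h2) ` regular_polygon n = regular_polygon n"
        unfolding image_comp[symmetric] using eng.IH by (simp add: symmetry_group_def)
      ultimately have "h1 \<circ> h2 \<in> symmetry_group (regular_polygon n)"
        unfolding symmetry_group_def by blast
      then show ?case using bij eng.IH by (simp only: mult_BijGroup)
    qed
  qed
  show "symmetry_group (regular_polygon n) \<subseteq> reflection_group (I2_roots n)"
  proof
    fix f assume f: "f \<in> symmetry_group (regular_polygon n)"
    then have orth: "orthogonal_transformation f" and img: "f ` regular_polygon n = regular_polygon n"
      by (auto simp: symmetry_group_def)
    have "?v 0 \<in> regular_polygon n" unfolding regular_polygon_alt by blast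
    then have "f (?v 0) \<in> regular_polygon n" using img by blast
    then obtain k where k: "f (?v 0) = ?v k" unfolding regular_polygon_alt by blast
    define g where "g = reflection (?r k) \<circ> f"
    have og: "orthogonal_transformation g"
      unfolding g_def
      by (intro orthogonal_transformation_compose orthogonal_transformation_reflection orth nz I2_root_in)
    have v0: "?v 0 = axis 2 1" by (simp add: vector2_eq_iff axis_def)
    have g2: "g (axis 2 1) = axis 2 1" using k rv[of k k] v0 by (simp add: g_def)
    define u where "u = g (axis 1 1)"
    have "u \<bullet> g (axis 2 1) = axis 1 1 \<bullet> (axis 2 1 :: real^2)" "u \<bullet> u = axis 1 1 \<bullet> (axis 1 1 :: real^2)"
      using og unfolding u_def orthogonal_transformation_def by blast+
    then have u2: "u $ 2 = 0" and "u $ 1 * u $ 1 = 1"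
      unfolding g2 by (simp_all add: inner_real2 axis_def)
    then have u1: "u $ 1 = 1 \<or> u $ 1 = - 1" by (simp add: square_eq_1_iff)
    have lin: "g x = x $ 1 *\<^sub>R u + x $ 2 *\<^sub>R axis 2 1" for x
    proof -
      have x: "x = x $ 1 *\<^sub>R axis 1 1 + x $ 2 *\<^sub>R axis 2 1" by (simp add: vector2_eq_iff axis_def)
      have "linear g" using og by (rule orthogonal_transformation_linear)
      then have "g (a *\<^sub>R axis 1 1 + b *\<^sub>R axis 2 1) = a *\<^sub>R u + b *\<^sub>R axis 2 1" for a b
        by (simp add: linear_add linear_scale g2 u_def)
      from this[of "x $ 1" "x $ 2"] show ?thesis by (simp only: x[symmetric])
    qed
    have g: "g = id \<or> g = reflection (?r 0)"
      using u1
    proof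
      assume "u $ 1 = 1"
      then have "g = id" by (intro ext) (subst lin, simp add: vector2_eq_iff u2 axis_def)
      then show ?thesis by blast
    next
      assume "u $ 1 = - 1"
      then have "g = reflection (?r 0)"
        by (intro ext) (subst lin, simp add: vector2_eq_iff u2 axis_def reflection_def inner_real2)
      then show ?thesis by blast
    qed
    have gen: "reflection (?r j) \<in> generate ?G (reflection ` I2_roots n)" for j
      by (rule generate.incl) (use I2_root_in in blast)
    have "f = reflection (?r k) \<circ> g" by (simp add: g_def fun_eq_iff reflection_reflection)
    then show "f \<in> reflection_group (I2_roots n)"
      using g gen[of k] generate.eng[OF gen[of k] gen[of 0]]
      by (auto simp: reflection_group_def mult_BijGroup reflection_bij)
  qed
qed

theorem A1_I2_root_system:
  assumes "n \<ge> 2"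
  shows "root_system (orthogonal_union A1_roots (I2_roots n))"
proof -
  let ?R = "orthogonal_union A1_roots (I2_roots n)"
  have rs: "root_system (I2_roots n)" by (rule I2_root_system[OF assms])
  have refl1: "reflection (a, 0) (x, y :: real^2) = (reflection a x, y)" for a x :: real and y
    by (simp add: reflection_def)
  have refl2: "reflection (0 :: real, b) (x, y :: real^2) = (x, reflection b y)" for b x y
    by (simp add: reflection_def)
  have fix1: "reflection a (0 :: real) = 0" for a by (simp add: reflection_def)
  have fix2: "reflection b (0 :: real^2) = 0" for b by (simp add: reflection_def)
  have A1: "reflection a ` A1_roots = A1_roots" if "a \<in> A1_roots" for a
    using that by (auto simp: A1_roots_def reflection_def)
  have "finite ?R" "0 \<notin> ?R"
    using rs by (auto simp: root_system_def orthogonal_union_def A1_roots_def zero_prod_def)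
  moreover have "span ?R = UNIV"
  proof -
    have "(x, y) \<in> span ?R" for x :: real and y :: "real^2"
    proof -
      have "(1, 0) \<in> ?R" by (simp add: orthogonal_union_def A1_roots_def)
      then have "x *\<^sub>R (1, 0) \<in> span ?R" by (intro span_scale span_base)
      moreover have "y \<in> span (I2_roots n)" using rs by (simp add: root_system_def)
      then have "(0, y) \<in> span ?R"
      proof (induction rule: span_induct_alt)
        case base
        then show ?case using span_zero[of ?R] by (simp add: zero_prod_def)
      next
        case (step c b z)
        then have "(0, b) \<in> span ?R" by (intro span_base) (simp add: orthogonal_union_def)
        then have "c *\<^sub>R (0, b) + (0, z) \<in> span ?R" using step by (intro span_add span_scale)
        then show ?case by simp
      qed
      ultimately have "x *\<^sub>R (1, 0) + (0, y) \<in> span ?R" by (rule span_add)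
      then show ?thesis by simp
    qed
    then show ?thesis by auto
  qed
  moreover have "?R \<inter> span {\<alpha>} = {\<alpha>, - \<alpha>} \<and> reflection \<alpha> ` ?R = ?R" if \<alpha>: "\<alpha> \<in> ?R" for \<alpha>
  proof -
    consider "\<alpha> \<in> (\<lambda>a. (a, 0)) ` A1_roots" | "\<alpha> \<in> (\<lambda>b. (0, b)) ` I2_roots n"
      using \<alpha> unfolding orthogonal_union_def by blast
    then show ?thesis
    proof cases
      case 1
      then obtain a where a: "\<alpha> = (a, 0)" "a \<in> A1_roots" by blast
      have "0 \<notin> I2_roots n" using rs by (simp add: root_system_def)
      then have "?R \<inter> span {\<alpha>} = {\<alpha>, - \<alpha>}"
        using a by (auto simp: orthogonal_union_def span_singleton A1_roots_def
            intro: range_eqI[where x = "1::real"] range_eqI[where x = "-1::real"])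
      moreover have "reflection \<alpha> ` ?R = ?R"
        using A1[OF a(2)] by (simp add: orthogonal_union_def image_Un image_image a refl1 fix1)
          (simp flip: image_image[of "\<lambda>x. (x, 0)" "reflection a"])
      ultimately show ?thesis by blast
    next
      case 2
      then obtain b where b: "\<alpha> = (0, b)" "b \<in> I2_roots n" by blast
      have I2: "I2_roots n \<inter> span {b} = {b, - b}" "reflection b ` I2_roots n = I2_roots n"
        using rs b by (auto simp: root_system_def)
      have "?R \<inter> span {\<alpha>} = (\<lambda>y. (0, y)) ` (I2_roots n \<inter> span {b})"
        by (auto simp: orthogonal_union_def span_singleton A1_roots_def b)
      then have "?R \<inter> span {\<alpha>} = {\<alpha>, - \<alpha>}" by (simp add: I2 b)
      moreover have "reflection \<alpha> ` ?R = ?R"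
        using I2(2) by (simp add: orthogonal_union_def image_Un image_image b refl2 fix2)
          (simp flip: image_image[of "\<lambda>x. (0, x)" "reflection b"])
      ultimately show ?thesis by blast
    qed
  qed
  ultimately show ?thesis by (simp add: root_system_def)
qed

theorem A1_I2_simple_roots:
  assumes "n \<ge> 2"
  shows "simple_roots (orthogonal_union A1_roots (I2_roots n)) [(1, 0), (0, I2_simple1), (0, I2_simple2 n)]"
proof -
  let ?a = "I2_simple1" and ?b = "I2_simple2 n"
  let ?R = "orthogonal_union A1_roots (I2_roots n)"
  let ?S = "set [(1::real, 0), (0, ?a), (0, ?b)]"
  have I2: "distinct [?a, ?b]" "set [?a, ?b] \<subseteq> I2_roots n" "independent (set [?a, ?b])"
    and comb: "\<And>\<beta>. \<beta> \<in> I2_roots n \<Longrightarrow> \<exists>c. \<beta> = (\<Sum>\<alpha>\<in>set [?a, ?b]. c \<alpha> *\<^sub>R \<alpha>) \<and>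
        ((\<forall>\<alpha>\<in>set [?a, ?b]. 0 \<le> c \<alpha>) \<or> (\<forall>\<alpha>\<in>set [?a, ?b]. c \<alpha> \<le> 0))"
    using I2_simple_roots[OF assms] unfolding simple_roots_def by blast+
  have "distinct [(1::real, 0), (0, ?a), (0, ?b)]" using I2(1) by simp
  moreover have "?S \<subseteq> ?R" using I2(2) by (auto simp: orthogonal_union_def A1_roots_def)
  moreover have cc: "\<exists>c. \<beta> = (\<Sum>\<alpha>\<in>?S. c \<alpha> *\<^sub>R \<alpha>) \<and> ((\<forall>\<alpha>\<in>?S. 0 \<le> c \<alpha>) \<or> (\<forall>\<alpha>\<in>?S. c \<alpha> \<le> 0))"
    if \<beta>: "\<beta> \<in> ?R" for \<beta>
  proof -
    consider "\<beta> \<in> (\<lambda>a. (a, 0)) ` A1_roots" | "\<beta> \<in> (\<lambda>b. (0, b)) ` I2_roots n"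
      using \<beta> unfolding orthogonal_union_def by blast
    then show ?thesis
    proof cases
      case 1
      then obtain x where x: "\<beta> = (x, 0)" "x = 1 \<or> x = - 1" by (auto simp: A1_roots_def)
      show ?thesis
        by (rule exI[of _ "\<lambda>\<alpha>. x * fst \<alpha>"]) (use x I2(1) in auto)
    next
      case 2
      then obtain y where y: "\<beta> = (0, y)" "y \<in> I2_roots n" by blast
      obtain c where c: "y = (\<Sum>\<alpha>\<in>set [?a, ?b]. c \<alpha> *\<^sub>R \<alpha>)"
          "(\<forall>\<alpha>\<in>set [?a, ?b]. 0 \<le> c \<alpha>) \<or> (\<forall>\<alpha>\<in>set [?a, ?b]. c \<alpha> \<le> 0)"
        using comb[OF y(2)] by blast
      show ?thesis
        by (rule exI[of _ "\<lambda>\<alpha>. if fst \<alpha> = 0 then c (snd \<alpha>) else 0"]) (use y c I2(1) in auto)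
    qed
  qed
  moreover have "independent ?S"
  proof -
    have "?R \<subseteq> span ?S"
    proof
      fix \<beta> assume "\<beta> \<in> ?R"
      from cc[OF this] obtain c where "\<beta> = (\<Sum>\<alpha>\<in>?S. c \<alpha> *\<^sub>R \<alpha>)" by blast
      then show "\<beta> \<in> span ?S" by (simp only:) (intro span_sum span_scale span_base)
    qed
    then have "span ?R \<subseteq> span ?S" by (rule span_minimal) (rule subspace_span)
    then have "span ?S = UNIV" using A1_I2_root_system[OF assms] by (auto simp: root_system_def)
    moreover have "card ?S = DIM(real \<times> (real^2))" using I2(1) by simp
    ultimately show ?thesis
      by (metis card_le_dim_spanning dim_UNIV finite_set le_refl top_greatest)
  qed
  ultimately show ?thesis unfolding simple_roots_def by blast
qed

section \<open>The root systems \<open>A\<^sub>3\<close>, \<open>B\<^sub>3\<close>, \<open>H\<^sub>3\<close>\<close>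

definition tetrahedron :: "(real^3) set" where
  "tetrahedron = {vector [1, 1, 1], vector [1, - 1, - 1], vector [- 1, 1, - 1], vector [- 1, - 1, 1]}"

definition octahedron :: "(real^3) set" where
  "octahedron = (\<Union>s\<in>{1, - 1}. {vector [s, 0, 0], vector [0, s, 0], vector [0, 0, s]})"

definition icosahedron :: "(real^3) set" where
  "icosahedron = (let \<phi> = (1 + sqrt 5) / 2 in
     \<Union>s\<in>{1, - 1}. \<Union>t\<in>{1, - 1}.
       {vector [0, s, t * \<phi>], vector [s, t * \<phi>, 0], vector [t * \<phi>, 0, s]})"

text \<open>\<open>V\<close> is the vertex set of a polyhedron centred at the origin, which may be rotated into any
  position; the reflection group has to be the whole symmetry group, not just to contain it or to
  be contained in it.\<close>

definition irreducible_with_symmetry_of :: "(real^3) set \<Rightarrow> (real^3) set \<Rightarrow> bool" where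
  "irreducible_with_symmetry_of V \<Phi> \<longleftrightarrow>
     root_system \<Phi> \<and> irreducible_roots \<Phi> \<and>
     (\<exists>Q. orthogonal_transformation Q \<and> reflection_group \<Phi> = symmetry_group (Q ` V))"

definition is_A3 :: "(real^3) set \<Rightarrow> bool" where
  "is_A3 = irreducible_with_symmetry_of tetrahedron"

definition is_B3 :: "(real^3) set \<Rightarrow> bool" where
  "is_B3 = irreducible_with_symmetry_of octahedron"

definition is_H3 :: "(real^3) set \<Rightarrow> bool" where
  "is_H3 = irreducible_with_symmetry_of icosahedron"


section \<open>Simply-laced diagrams\<close>

text \<open>An undirected simple graph is represented by the digraph that has both orientations of
  every edge as arcs.\<close>

definition diagram :: "'v set \<Rightarrow> ('v \<times> 'v) set \<Rightarrow> 'v pair_pre_digraph" where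
  "diagram V E = \<lparr> pverts = V, parcs = E \<union> E\<inverse> \<rparr>"

definition diagram_iso :: "'v pair_pre_digraph \<Rightarrow> 'w pair_pre_digraph \<Rightarrow> bool" where
  "diagram_iso G H \<longleftrightarrow> digraph_iso (with_proj G) (with_proj H)"

definition single_leg :: "nat \<Rightarrow> nat pair_pre_digraph" where
  "single_leg n = diagram {k. k < n} {(k, Suc k) | k. Suc k < n}"

text \<open>The node at distance \<open>k\<close> from the central node on leg \<open>i\<close>; the central node belongs to all
  legs.\<close>

definition leg_node :: "nat \<Rightarrow> nat \<Rightarrow> nat \<times> nat" where
  "leg_node i k = (if k = 0 then (0, 0) else (i, k))"

definition T_diagram :: "nat \<Rightarrow> nat \<Rightarrow> nat \<Rightarrow> (nat \<times> nat) pair_pre_digraph" where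
  "T_diagram p q r = (let len = (\<lambda>i. [p, q, r] ! i) in
     diagram {leg_node i k | i k. i < 3 \<and> k < len i}
             {(leg_node i k, leg_node i (Suc k)) | i k. i < 3 \<and> Suc k < len i})"

text \<open>The Dynkin diagrams of types \<open>A\<^sub>n\<close> (\<open>n \<ge> 1\<close>), \<open>D\<^sub>n\<close> (\<open>n \<ge> 4\<close>) and \<open>E\<^sub>n\<close> (\<open>6 \<le> n \<le> 8\<close>), with
  the nodes numbered as in Bourbaki.\<close>

definition Dynkin_A :: "nat \<Rightarrow> nat pair_pre_digraph" where
  "Dynkin_A n = diagram {1..n} {(i, i + 1) | i. 1 \<le> i \<and> i + 1 \<le> n}"

definition Dynkin_D :: "nat \<Rightarrow> nat pair_pre_digraph" where
  "Dynkin_D n = diagram {1..n} ({(i, i + 1) | i. 1 \<le> i \<and> i + 1 \<le> n - 1} \<union> {(n - 2, n)})"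

definition Dynkin_E :: "nat \<Rightarrow> nat pair_pre_digraph" where
  "Dynkin_E n = diagram {1..n} ({(1, 3), (2, 4)} \<union> {(i, i + 1) | i. 3 \<le> i \<and> i + 1 \<le> n})"

end

theory Submission imports Defs begin

text \<open>The product of the reflections in unit vectors with inner product \<open>cos (pi / n)\<close> has order
  \<open>n\<close>. For an irreducible root system with simple roots \<open>\<alpha>\<close>, \<open>\<beta>\<close>, \<open>\<gamma>\<close> the sign condition on the
  coefficients of roots forces the cosine of the angle between two simple roots to be \<open>0\<close> or at most
  \<open>- 1 / 2\<close>. Irreducibility excludes two orthogonal pairs among the three, and linear independence
  excludes that no pair is orthogonal (three unit vectors with cosines at most \<open>- 1 / 2\<close> sum up to
  \<open>0\<close>). So, after renaming, \<open>\<alpha>\<close> and \<open>\<gamma>\<close> are orthogonal, and by Bessel's inequality the squares of the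
  other two cosines add up to less than \<open>1\<close>.

  A reflection that preserves the vertices of a polyhedron has its root along a difference of two
  vertices. This leaves the squared cosines \<open>0\<close>, \<open>1 / 4\<close> for the tetrahedron, in addition \<open>1 / 2\<close> for
  the octahedron, and \<open>0\<close>, \<open>1 / 4\<close>, \<open>\<phi>\<^sup>2 / 4\<close>, \<open>(\<phi> - 1)\<^sup>2 / 4\<close> for the icosahedron, with \<open>\<phi>\<close> the golden
  ratio. The orders are then determined, except that \<open>{2, 3, 3}\<close> has to be excluded for
  \<open>B\<^sub>3\<close> and \<open>H\<^sub>3\<close>.
  For \<open>B\<^sub>3\<close>, the group contains \<open>- 1\<close>, so some root lies along a coordinate axis, and such a root
  violates the sign condition with respect to simple roots of type \<open>A\<^sub>3\<close>. For \<open>H\<^sub>3\<close>, the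
  determinant of three suitably scaled simple roots of type \<open>A\<^sub>3\<close> would be a square root of \<open>32\<close> in
  \<open>\<int>[\<phi>]\<close>.\<close>

section \<open>Dynkin diagrams\<close>

text \<open>A diagram is the symmetric closure of a chosen orientation, so only the closures have to
  agree: \<open>h\<close> may reverse some of the chosen arcs, as it does on the long leg in
  \<open>T_22n_iso\<close>. Arcs are pairs of nodes, hence \<open>map_prod h h\<close> is the arc
  map that goes with \<open>h\<close>.\<close>

lemma diagram_isoI:
  assumes inj: "inj_on h V" and W: "h ` V = W" and E: "E \<subseteq> V \<times> V"
    and F: "map_prod h h ` E \<union> (map_prod h h ` E)\<inverse> = F \<union> F\<inverse>"
  shows "diagram_iso (diagram V E) (diagram W F)"
proof -
  let ?f = "\<lparr>iso_verts = h, iso_arcs = map_prod h h, iso_head = snd, iso_tail = fst\<rparr>"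
  let ?G = "with_proj (diagram V E)"
  have sub: "E \<union> E\<inverse> \<subseteq> V \<times> V" using E by auto
  have "inj_on (map_prod h h) (V \<times> V)" by (rule map_prod_inj_on[OF inj inj])
  then have injE: "inj_on (map_prod h h) (E \<union> E\<inverse>)" using sub by (rule inj_on_subset)
  have "map_prod h h ` E\<inverse> = (map_prod h h ` E)\<inverse>" by force
  then have img: "map_prod h h ` (E \<union> E\<inverse>) = F \<union> F\<inverse>" using F by (simp add: image_Un)
  have wf: "wf_digraph ?G" by unfold_locales (use sub in \<open>auto simp: diagram_def\<close>)
  have "pre_digraph.digraph_isomorphism ?G ?f"
    unfolding pre_digraph.digraph_isomorphism_def using wf inj injE
    by (auto simp: diagram_def)
  moreover have "with_proj (diagram W F) = app_iso ?f ?G"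
    using W img by (simp add: app_iso_def with_proj_def diagram_def)
  ultimately show ?thesis unfolding diagram_iso_def digraph_iso_def by blast
qed

lemma single_leg_iso: "diagram_iso (single_leg n) (Dynkin_A n)"
  unfolding single_leg_def Dynkin_A_def
proof (rule diagram_isoI[where h = Suc])
  show "Suc ` {k. k < n} = {1..n}"
    by (auto simp: image_iff Suc_le_eq dest!: less_imp_Suc_add)
  have "map_prod Suc Suc ` {(k, Suc k) | k. Suc k < n} = {(i, i + 1) | i. 1 \<le> i \<and> i + 1 \<le> n}"
    by (auto simp: image_iff Suc_le_eq dest!: less_imp_Suc_add)
  then show "map_prod Suc Suc ` {(k, Suc k) | k. Suc k < n} \<union> (map_prod Suc Suc ` {(k, Suc k) | k. Suc k < n})\<inverse> =
    {(i, i + 1) | i. 1 \<le> i \<and> i + 1 \<le> n} \<union> {(i, i + 1) | i. 1 \<le> i \<and> i + 1 \<le> n}\<inverse>"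
    by simp
qed auto

text \<open>Separates the central node, which \<open>leg_node\<close> shares between the legs, so
  that images under a relabelling can be computed leg by leg. Lengths of at least 2 guarantee that
  all three arcs at the centre exist.\<close>

lemma T_diagram_alt:
  assumes "p \<ge> 2" "q \<ge> 2" "r \<ge> 2"
  shows "T_diagram p q r = diagram
    ({(0, 0)} \<union> Pair 0 ` {1..<p} \<union> Pair 1 ` {1..<q} \<union> Pair 2 ` {1..<r})
    ({((0, 0), (0, 1)), ((0, 0), (1, 1)), ((0, 0), (2, 1))} \<union> (\<lambda>k. ((0, k), (0, Suc k))) ` {1..<p - 1}
      \<union> (\<lambda>k. ((1, k), (1, Suc k))) ` {1..<q - 1} \<union> (\<lambda>k. ((2, k), (2, Suc k))) ` {1..<r - 1})"
proof -
  have V: "leg_node i ` {..<m} = insert (0, 0) (Pair i ` {1..<m})" if "m \<ge> 2" for i m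
  proof -
    have "{..<m} = insert 0 {1..<m}" using that by auto
    moreover have "leg_node i ` {1..<m} = Pair i ` {1..<m}" by (rule image_cong) (auto simp: leg_node_def)
    ultimately show ?thesis by (simp only: image_insert) (simp add: leg_node_def)
  qed
  have E: "(\<lambda>k. (leg_node i k, leg_node i (Suc k))) ` {..<m - 1}
      = insert ((0, 0), (i, 1)) ((\<lambda>k. ((i, k), (i, Suc k))) ` {1..<m - 1})" if "m \<ge> 2" for i m
  proof -
    have "{..<m - 1} = insert 0 {1..<m - 1}" using that by auto
    moreover have "(\<lambda>k. (leg_node i k, leg_node i (Suc k))) ` {1..<m - 1} = (\<lambda>k. ((i, k), (i, Suc k))) ` {1..<m - 1}"
      by (rule image_cong) (auto simp: leg_node_def)
    ultimately show ?thesis by (simp only: image_insert) (simp add: leg_node_def)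
  qed
  have three: "{i :: nat. i < 3} = {0, 1, 2}" by auto
  have "{leg_node i k | i k. i < 3 \<and> k < [p, q, r] ! i} = (\<Union>i\<in>{0, 1, 2}. leg_node i ` {..<[p, q, r] ! i})"
    unfolding three[symmetric] by blast
  also have "\<dots> = {(0, 0)} \<union> Pair 0 ` {1..<p} \<union> Pair 1 ` {1..<q} \<union> Pair 2 ` {1..<r}"
    using assms by (simp add: V) blast
  finally have VT: "{leg_node i k | i k. i < 3 \<and> k < [p, q, r] ! i} = \<dots>" .
  have m: "{..<m - 1} = {k. Suc k < m}" for m by auto
  have "{(leg_node i k, leg_node i (Suc k)) | i k. i < 3 \<and> Suc k < [p, q, r] ! i}
      = (\<Union>i\<in>{0, 1, 2}. (\<lambda>k. (leg_node i k, leg_node i (Suc k))) ` {..<[p, q, r] ! i - 1})"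
    unfolding three[symmetric] m by blast
  also have "\<dots> = {((0, 0), (0, 1)), ((0, 0), (1, 1)), ((0, 0), (2, 1))} \<union> (\<lambda>k. ((0, k), (0, Suc k))) ` {1..<p - 1}
      \<union> (\<lambda>k. ((1, k), (1, Suc k))) ` {1..<q - 1} \<union> (\<lambda>k. ((2, k), (2, Suc k))) ` {1..<r - 1}"
    using assms E[of p 0] E[of q 1] E[of r 2] by simp blast
  finally have ET: "{(leg_node i k, leg_node i (Suc k)) | i k. i < 3 \<and> Suc k < [p, q, r] ! i} = \<dots>" .
  show ?thesis unfolding T_diagram_def Let_def VT ET ..
qed

lemma T_22n_iso:
  assumes "n \<ge> 2"
  shows "diagram_iso (T_diagram 2 2 n) (Dynkin_D (n + 2))"
proof -
  \<comment> \<open>The centre becomes the branch node \<open>n\<close>, the long leg descends from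
    it to 1, and the tips of the two short legs become \<open>n + 1\<close> and
    \<open>n + 2\<close>.\<close>
  define h :: "nat \<times> nat \<Rightarrow> nat" where
    "h = (\<lambda>(i, k). if i = 2 then n - k else if k = 0 then n else n + 1 + i)"
  have one: "{1..<2::nat} = {1}" by auto
  have im: "(\<lambda>k. n - k) ` {Suc 0..<n} = {Suc 0..<n}"
  proof -
    have "x \<in> (\<lambda>k. n - k) ` {Suc 0..<n}" if "x \<in> {Suc 0..<n}" for x
      by (rule image_eqI[of _ _ "n - x"]) (use that in auto)
    then show ?thesis by auto
  qed
  \<comment> \<open>The image of the long leg without its arc at the centre. It runs towards smaller
    labels, against the orientation in \<open>Dynkin_D\<close>.\<close>
  define E where "E = (\<lambda>k. (n - k, n - Suc k)) ` {1..<n - 1}"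
  have E: "E\<inverse> = (\<lambda>i. (i, i + 1)) ` {1..<n - 1}"
  proof -
    have "(i + 1, i) \<in> E" if "i \<in> {1..<n - 1}" for i
      unfolding E_def by (rule image_eqI[of _ _ "n - Suc i"]) (use that in auto)
    moreover have "(n - Suc k, n - k) \<in> (\<lambda>i. (i, i + 1)) ` {1..<n - 1}" if "k \<in> {1..<n - 1}" for k
      by (rule image_eqI[of _ _ "n - Suc k"]) (use that in auto)
    ultimately show ?thesis unfolding E_def by blast
  qed
  have F: "{(i, i + 1) | i. 1 \<le> i \<and> i + 1 \<le> n + 2 - 1} \<union> {(n + 2 - 2, n + 2)}
      = E\<inverse> \<union> {(n - 1, n), (n, n + 1), (n, n + 2)}"
  proof -
    have "{(i, i + 1) | i. 1 \<le> i \<and> i + 1 \<le> n + 2 - 1} = (\<lambda>i. (i, i + 1)) ` {1..n}"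
      by (auto simp del: One_nat_def)
    also have "{1..n} = {1..<n - 1} \<union> {n - 1, n}" using assms by auto
    finally show ?thesis using assms unfolding E image_Un by (simp add: insert_commute)
  qed
  show ?thesis
    unfolding Dynkin_D_def T_diagram_alt[OF order_refl order_refl assms] F one
  proof (rule diagram_isoI[where h = h], goal_cases)
    case 1
    show ?case by (auto simp: inj_on_def h_def)
  next
    case 2
    have "{1..n + 2} = {n, n + 1, n + 2} \<union> {1..<n}" using assms by auto
    then show ?case by (simp add: image_Un image_image h_def im insert_commute)
  next
    case 3
    show ?case using assms by (simp add: image_subset_iff image_iff) auto
  next
    case 4
    have "(\<lambda>k. (n - k, n - Suc k)) ` {Suc 0..<n - Suc 0} = E" by (simp add: E_def)
    then show ?case by (simp add: image_Un image_image h_def converse_Un) auto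
  qed
qed

lemma T_23r_iso:
  assumes "r \<ge> 2"
  shows "diagram_iso (T_diagram 2 3 r) (Dynkin_E (r + 3))"
proof -
  \<comment> \<open>In Bourbaki's numbering the branch node is 4; the leg of length 3 continues with
    3 and 1 (the values of \<open>5 - 2 * k\<close>), the leg of length 2 with 2, and the leg of
    length \<open>r\<close> with 5, 6 and so on.\<close>
  define h :: "nat \<times> nat \<Rightarrow> nat" where
    "h = (\<lambda>(i, k). if i = 2 then 4 + k else if k = 0 then 4 else if i = 1 then 5 - 2 * k else 2)"
  have ivl: "{Suc 0..<2} = {1}" "{Suc 0..<3} = {1, 2}" by auto
  have im: "(\<lambda>k. 4 + k) ` {Suc 0..<r} = {5..<r + 4}"
    using image_add_atLeastLessThan[of 4 1 r] by (simp add: add.commute)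
  define E where "E = (\<lambda>k. (4 + k, 4 + Suc k)) ` {1..<r - 1}"
  have F: "{(1, 3), (2, 4)} \<union> {(i, i + 1) | i. 3 \<le> i \<and> i + 1 \<le> r + 3} = E \<union> {(1, 3), (2, 4), (3, 4), (4, 5)}"
  proof -
    have "{(i, i + 1) | i. 3 \<le> i \<and> i + 1 \<le> r + 3} = (\<lambda>i. (i, i + 1)) ` {3..<r + 3}"
      by auto
    also have "{3..<r + 3} = {3, 4} \<union> (\<lambda>k. 4 + k) ` {1..<r - 1}"
      unfolding image_add_atLeastLessThan using assms by auto
    finally show ?thesis unfolding E_def image_Un image_image by auto
  qed
  show ?thesis
    unfolding Dynkin_E_def T_diagram_alt[OF order_refl _ assms, of 3, simplified] F
  proof (rule diagram_isoI[where h = h], goal_cases)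
    case 1
    show ?case by (auto simp: inj_on_def h_def ivl)
  next
    case 2
    have "{1..r + 3} = {1, 2, 3, 4} \<union> {5..<r + 4}" using assms by auto
    then show ?case by (simp add: image_Un image_image h_def ivl im insert_commute)
  next
    case 3
    show ?case using assms by (simp add: image_subset_iff image_iff ivl) auto
  next
    case 4
    have "(\<lambda>k. (4 + k, 5 + k)) ` {Suc 0..<r - 1} = E" by (simp add: E_def)
    then show ?case by (simp add: image_Un image_image h_def ivl converse_Un) auto
  qed
qed

section \<open>The order of a product of two reflections\<close>

lemma reflection_scaleR_root: "c \<noteq> 0 \<Longrightarrow> reflection (c *\<^sub>R \<alpha>) = reflection \<alpha>"
  by (auto simp: reflection_def fun_eq_iff)

lemma reflection_self: "reflection \<alpha> \<alpha> = - \<alpha>"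
  by (cases "\<alpha> = 0") (simp_all add: reflection_def scaleR_2)

lemma reflection_sgn: "reflection (sgn \<alpha>) = reflection \<alpha>"
  by (cases "\<alpha> = 0") (simp_all add: sgn_div_norm reflection_scaleR_root)

lemma linear_reflection: "linear (reflection \<alpha>)"
  by (rule linearI)
     (simp_all add: reflection_def inner_add_left distrib_left add_divide_distrib
       scaleR_add_left scaleR_diff_right)

lemma reflection_minus: "reflection \<alpha> (- x) = - reflection \<alpha> x"
  using linear_neg[OF linear_reflection] .

lemma linear_reflection_comp_funpow: "linear ((reflection a \<circ> reflection b) ^^ k)"
proof (induction k)
  case 0
  show ?case using linear_id by (simp add: id_def)
next
  case (Suc k)
  show ?case
    unfolding funpow.simps(2)
    by (rule linear_compose[OF Suc linear_compose[OF linear_reflection linear_reflection]])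
qed

text \<open>For independent \<open>a\<close> and \<open>b\<close> the product is a rotation through
  twice the angle \<theta> in their plane; these are the coordinates of its powers in the basis
  \<open>a\<close>, \<open>b\<close>. The factor \<open>sin \<theta>\<close> avoids a division. Both
  formulas are proved together because \<open>f a\<close> and \<open>f b\<close> each involve both
  vectors.\<close>

lemma reflection_reflection_funpow:
  fixes a b :: "'a::euclidean_space"
  assumes a: "a \<bullet> a = 1" and b: "b \<bullet> b = 1" and ab: "a \<bullet> b = cos \<theta>"
  shows "sin \<theta> *\<^sub>R ((reflection a \<circ> reflection b) ^^ k) a
           = sin ((2 * real k + 1) * \<theta>) *\<^sub>R a - sin (2 * real k * \<theta>) *\<^sub>R b"
    and "sin \<theta> *\<^sub>R ((reflection a \<circ> reflection b) ^^ k) b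
           = sin (2 * real k * \<theta>) *\<^sub>R a - sin ((2 * real k - 1) * \<theta>) *\<^sub>R b"
proof (induction k)
  case 0
  { case 1 show ?case by simp next case 2 show ?case by simp }
next
  case (Suc k)
  define f where "f = reflection a \<circ> reflection b"
  define t where "t = 2 * real k * \<theta>"
  have lin: "linear (f ^^ k)"
    unfolding f_def by (rule linear_reflection_comp_funpow)
  have ba: "b \<bullet> a = cos \<theta>" using ab by (simp add: inner_commute)
  have fb: "f b = (2 * cos \<theta>) *\<^sub>R a - b"
    using a ba by (simp add: f_def reflection_self reflection_minus) (simp add: reflection_def)
  have "reflection b a = a - (2 * cos \<theta>) *\<^sub>R b" using b ab by (simp add: reflection_def)
  then have "f a = reflection a a - (2 * cos \<theta>) *\<^sub>R reflection a b"
    by (simp add: f_def linear_diff[OF linear_reflection] linear_scale[OF linear_reflection])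
  also have "reflection a b = b - (2 * cos \<theta>) *\<^sub>R a" using a ba by (simp add: reflection_def)
  finally have fa: "f a = (4 * (cos \<theta>)\<^sup>2 - 1) *\<^sub>R a - (2 * cos \<theta>) *\<^sub>R b"
    by (simp add: reflection_self algebra_simps power2_eq_square)
  \<comment> \<open>The three-term recurrence for sines at equally spaced angles. The coefficients
    in \<open>f a\<close> and \<open>f b\<close> are polynomials in \<open>2 * cos \<theta>\<close>,
    so the induction step reduces to a few instances of it.\<close>
  have h: "2 * cos \<theta> * sin x = sin (x + \<theta>) + sin (x - \<theta>)" for x
    by (simp add: sin_add sin_diff)
  have angles: "(2 * real (Suc k) + 1) * \<theta> = t + \<theta> + \<theta> + \<theta>" "2 * real (Suc k) * \<theta> = t + \<theta> + \<theta>"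
    "(2 * real (Suc k) - 1) * \<theta> = t + \<theta>" "(2 * real k + 1) * \<theta> = t + \<theta>" "(2 * real k - 1) * \<theta> = t - \<theta>"
    by (simp_all add: t_def algebra_simps)
  have IH: "sin \<theta> *\<^sub>R (f ^^ k) a = sin (t + \<theta>) *\<^sub>R a - sin t *\<^sub>R b"
    "sin \<theta> *\<^sub>R (f ^^ k) b = sin t *\<^sub>R a - sin (t - \<theta>) *\<^sub>R b"
    using Suc.IH unfolding angles f_def[symmetric] t_def[symmetric] by - assumption+
  have h2: "4 * (cos \<theta>)\<^sup>2 * sin x = 2 * cos \<theta> * sin (x + \<theta>) + 2 * cos \<theta> * sin (x - \<theta>)" for x
    using arg_cong[OF h[of x], of "\<lambda>y. 2 * cos \<theta> * y"] by (simp only: power2_eq_square distrib_left ac_simps)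
  have s: "(4 * (cos \<theta>)\<^sup>2 - 1) * sin (t + \<theta>) - 2 * cos \<theta> * sin t = sin (t + \<theta> + \<theta> + \<theta>)"
    "(4 * (cos \<theta>)\<^sup>2 - 1) * sin t - 2 * cos \<theta> * sin (t - \<theta>) = sin (t + \<theta> + \<theta>)"
    "2 * cos \<theta> * sin (t + \<theta>) - sin t = sin (t + \<theta> + \<theta>)"
    "2 * cos \<theta> * sin t - sin (t - \<theta>) = sin (t + \<theta>)"
    using h[of t] h[of "t + \<theta>"] h[of "t + \<theta> + \<theta>"] h2[of t] h2[of "t + \<theta>"] by (simp_all add: left_diff_distrib add.commute[of \<theta> t])
  { case 1
    have "sin \<theta> *\<^sub>R (f ^^ Suc k) a = sin \<theta> *\<^sub>R (f ^^ k) (f a)" by (simp add: funpow_swap1)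
    also have "\<dots> = (4 * (cos \<theta>)\<^sup>2 - 1) *\<^sub>R (sin \<theta> *\<^sub>R (f ^^ k) a) - (2 * cos \<theta>) *\<^sub>R (sin \<theta> *\<^sub>R (f ^^ k) b)"
      unfolding fa linear_diff[OF lin] linear_scale[OF lin] by (simp add: algebra_simps)
    also have "\<dots> = ((4 * (cos \<theta>)\<^sup>2 - 1) * sin (t + \<theta>) - 2 * cos \<theta> * sin t) *\<^sub>R a
        - ((4 * (cos \<theta>)\<^sup>2 - 1) * sin t - 2 * cos \<theta> * sin (t - \<theta>)) *\<^sub>R b"
      unfolding IH by (simp add: algebra_simps)
    finally show ?case unfolding s angles f_def .
  next
    case 2
    have "sin \<theta> *\<^sub>R (f ^^ Suc k) b = sin \<theta> *\<^sub>R (f ^^ k) (f b)" by (simp add: funpow_swap1)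
    also have "\<dots> = (2 * cos \<theta>) *\<^sub>R (sin \<theta> *\<^sub>R (f ^^ k) a) - sin \<theta> *\<^sub>R (f ^^ k) b"
      unfolding fb linear_diff[OF lin] linear_scale[OF lin] by (simp add: algebra_simps)
    also have "\<dots> = (2 * cos \<theta> * sin (t + \<theta>) - sin t) *\<^sub>R a - (2 * cos \<theta> * sin t - sin (t - \<theta>)) *\<^sub>R b"
      unfolding IH by (simp add: algebra_simps)
    finally show ?case unfolding s angles f_def . }
qed

lemma funpow_eq_id_iff:
  fixes a b :: "'a::euclidean_space" and n :: nat
  assumes n: "n \<ge> 2" and a: "a \<bullet> a = 1" and b: "b \<bullet> b = 1" and ab: "a \<bullet> b = cos (pi / n)"
  shows "(reflection a \<circ> reflection b) ^^ k = id \<longleftrightarrow> n dvd k"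
proof -
  define \<theta> where "\<theta> = pi / n"
  define f where "f = reflection a \<circ> reflection b"
  have s: "sin \<theta> > 0" unfolding \<theta>_def by (rule I2_sin_pos[OF n])
  have ab': "a \<bullet> b = cos \<theta>" by (simp add: ab \<theta>_def)
  note pow = reflection_reflection_funpow[OF a b ab', of k, folded f_def]
  have lin: "linear (f ^^ k)" for k
    unfolding f_def by (rule linear_reflection_comp_funpow)
  have angles: "(2 * real k + 1) * \<theta> = 2 * real k * \<theta> + \<theta>" "(2 * real k - 1) * \<theta> = 2 * real k * \<theta> - \<theta>"
    by (simp_all add: algebra_simps)
  show ?thesis unfolding f_def[symmetric]
  proof
    assume "f ^^ k = id"
    then have "sin \<theta> *\<^sub>R a = sin (2 * real k * \<theta> + \<theta>) *\<^sub>R a - sin (2 * real k * \<theta>) *\<^sub>R b"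
      using pow(1) by (simp add: angles)
    \<comment> \<open>Pairing with \<open>a\<close> makes the addition theorem collapse the
      right-hand side to \<open>sin \<theta> * cos (2 * real k * \<theta>)\<close>.\<close>
    then have "(sin \<theta> *\<^sub>R a) \<bullet> a = (sin (2 * real k * \<theta> + \<theta>) *\<^sub>R a - sin (2 * real k * \<theta>) *\<^sub>R b) \<bullet> a"
      by simp
    then have "sin \<theta> = sin \<theta> * cos (2 * real k * \<theta>)"
      using a ab' by (simp add: inner_diff_left inner_commute[of b] sin_add)
    then have "cos (2 * real k * \<theta>) = 1" using s by simp
    then obtain m :: int where "2 * real k * \<theta> = m * 2 * pi" by (auto simp: cos_one_2pi_int)
    then have "real k = real_of_int (m * int n)" using n by (simp add: \<theta>_def field_simps)
    then have "int k = m * int n" by (metis of_int_eq_iff of_int_of_nat_eq)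
    then show "n dvd k" by (metis dvd_triv_right int_dvd_int_iff)
  next
    assume "n dvd k"
    then obtain m where "k = n * m" by blast
    then have "2 * real k * \<theta> = 2 * pi * of_int (int m)" using n by (simp add: \<theta>_def)
    then have "sin (2 * real k * \<theta>) = 0" "cos (2 * real k * \<theta>) = 1"
      by (simp_all only: sin_int_2pin cos_int_2pin)
    then have fa: "(f ^^ k) a = a" and fb: "(f ^^ k) b = b"
      using pow s unfolding angles by (simp_all add: sin_add sin_diff)
    show "f ^^ k = id"
    proof
      fix x
      have s2: "(sin \<theta>)\<^sup>2 = 1 - (cos \<theta>)\<^sup>2" by (simp add: sin_squared_eq)
      \<comment> \<open>\<open>p\<close> and \<open>q\<close> solve the linear system with the Gram
        matrix of \<open>a\<close>, \<open>b\<close>, whose determinant is the square of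
        \<open>sin \<theta>\<close>. So \<open>y\<close> is the part of \<open>x\<close> orthogonal
        to both vectors, and it is fixed by both reflections.\<close>
      define p where "p = (x \<bullet> a - cos \<theta> * (x \<bullet> b)) / (sin \<theta>)\<^sup>2"
      define q where "q = (x \<bullet> b - cos \<theta> * (x \<bullet> a)) / (sin \<theta>)\<^sup>2"
      define y where "y = x - p *\<^sub>R a - q *\<^sub>R b"
      have nz: "(sin \<theta>)\<^sup>2 \<noteq> 0" using s by simp
      have pq: "p * (sin \<theta>)\<^sup>2 = x \<bullet> a - cos \<theta> * (x \<bullet> b)" "q * (sin \<theta>)\<^sup>2 = x \<bullet> b - cos \<theta> * (x \<bullet> a)"
        using nz unfolding p_def q_def by simp_all
      have "y \<bullet> a = x \<bullet> a - p - q * cos \<theta>" "y \<bullet> b = x \<bullet> b - p * cos \<theta> - q"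
        using a b ab' by (simp_all add: y_def inner_diff_left inner_commute[of b a])
      then have "(y \<bullet> a) * (sin \<theta>)\<^sup>2 = (x \<bullet> a) * (sin \<theta>)\<^sup>2 - p * (sin \<theta>)\<^sup>2 - cos \<theta> * (q * (sin \<theta>)\<^sup>2)"
        "(y \<bullet> b) * (sin \<theta>)\<^sup>2 = (x \<bullet> b) * (sin \<theta>)\<^sup>2 - cos \<theta> * (p * (sin \<theta>)\<^sup>2) - q * (sin \<theta>)\<^sup>2"
        by (simp_all add: left_diff_distrib)
      then have "(y \<bullet> a) * (sin \<theta>)\<^sup>2 = 0" "(y \<bullet> b) * (sin \<theta>)\<^sup>2 = 0"
        unfolding pq unfolding s2 by (simp_all add: algebra_simps power2_eq_square)
      then have "y \<bullet> a = 0" "y \<bullet> b = 0" using nz by simp_all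
      then have fy: "f y = y" by (simp add: f_def reflection_def)
      have "(f ^^ k) y = y" by (induction k) (simp_all add: fy)
      moreover have "x = p *\<^sub>R a + q *\<^sub>R b + y" by (simp add: y_def)
      ultimately show "(f ^^ k) x = id x"
        by (simp add: linear_add[OF lin] linear_scale[OF lin] fa fb)
    qed
  qed
qed

lemma nat_pow_BijGroup: "bij f \<Longrightarrow> f [^]\<^bsub>BijGroup UNIV\<^esub> (k::nat) = f ^^ k"
proof (induction k)
  case 0
  then show ?case by (simp add: one_BijGroup)
next
  case (Suc k)
  have "bij (f ^^ k)" using Suc.prems by (rule bij_betw_funpow)
  then show ?case using Suc by (simp add: mult_BijGroup funpow_Suc_right del: funpow.simps)
qed

text \<open>The square of the cosine suffices: negating a root leaves its reflection unchanged, so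
  the sign can be chosen to fit \<open>funpow_eq_id_iff\<close>.\<close>

lemma rotation_order_eq:
  assumes n: "n \<ge> 2" and nz: "\<alpha> \<noteq> 0" "\<beta> \<noteq> 0" and ab: "(sgn \<alpha> \<bullet> sgn \<beta>)\<^sup>2 = (cos (pi / n))\<^sup>2"
  shows "rotation_order \<alpha> \<beta> = n"
proof -
  interpret group "BijGroup (UNIV :: 'a set)" by (rule group_BijGroup)
  define b where "b = (if sgn \<alpha> \<bullet> sgn \<beta> = cos (pi / n) then sgn \<beta> else - sgn \<beta>)"
  have unit: "sgn \<alpha> \<bullet> sgn \<alpha> = 1" "b \<bullet> b = 1"
    using nz by (simp_all add: b_def norm_sgn flip: power2_norm_eq_inner)
  have "sgn \<alpha> \<bullet> b = cos (pi / n)" using ab by (auto simp: b_def power2_eq_iff)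
  note iff = funpow_eq_id_iff[OF n unit this]
  have "reflection b = reflection \<beta>"
    using reflection_scaleR_root[of "-1" "sgn \<beta>"] by (simp add: b_def reflection_sgn)
  then have iff: "(reflection \<alpha> \<circ> reflection \<beta>) ^^ k = id \<longleftrightarrow> n dvd k" for k
    using iff by (simp add: reflection_sgn)
  have bij: "bij (reflection \<alpha> \<circ> reflection \<beta>)" by (intro bij_comp reflection_bij)
  then have "reflection \<alpha> \<circ> reflection \<beta> \<in> carrier (BijGroup UNIV)"
    by (simp add: BijGroup_def Bij_def)
  then show ?thesis
    unfolding rotation_order_def by (metis ord_unique iff nat_pow_BijGroup[OF bij] one_BijGroup)
qed

text \<open>The two products are inverse to each other.\<close>

lemma rotation_order_commute: "rotation_order \<alpha> \<beta> = rotation_order \<beta> \<alpha>"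
proof -
  interpret group "BijGroup (UNIV :: 'a set)" by (rule group_BijGroup)
  have c: "reflection \<gamma> \<in> carrier (BijGroup UNIV)" for \<gamma> :: 'a
    by (simp add: BijGroup_def Bij_def reflection_bij)
  have "inv\<^bsub>BijGroup UNIV\<^esub> (reflection \<alpha> \<circ> reflection \<beta>) = reflection \<beta> \<circ> reflection \<alpha>"
    using inv_mult_group[OF c c, of \<alpha> \<beta>] by (simp add: mult_BijGroup reflection_bij inv_reflection_BijGroup)
  moreover have "reflection \<alpha> \<circ> reflection \<beta> \<in> carrier (BijGroup UNIV)"
    using m_closed[OF c c, of \<alpha> \<beta>] by (simp add: mult_BijGroup reflection_bij)
  ultimately show ?thesis unfolding rotation_order_def using ord_inv by metis
qed

section \<open>Three simple roots of an irreducible root system\<close>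

text \<open>Independence makes the coefficients unique, so the sign condition in
  \<open>simple_roots\<close> holds for any explicit way of writing a root.\<close>

lemma simple_roots_coherent:
  assumes s: "simple_roots \<Phi> [\<alpha>, \<beta>, \<gamma>]" and \<rho>: "p *\<^sub>R \<alpha> + q *\<^sub>R \<beta> + r *\<^sub>R \<gamma> \<in> \<Phi>"
  shows "0 \<le> p \<and> 0 \<le> q \<and> 0 \<le> r \<or> p \<le> 0 \<and> q \<le> 0 \<and> r \<le> 0"
proof -
  have d: "\<alpha> \<noteq> \<beta>" "\<alpha> \<noteq> \<gamma>" "\<beta> \<noteq> \<gamma>" and ind: "independent {\<alpha>, \<beta>, \<gamma>}"
    using s by (auto simp: simple_roots_def)
  obtain c where c: "p *\<^sub>R \<alpha> + q *\<^sub>R \<beta> + r *\<^sub>R \<gamma> = (\<Sum>\<alpha>\<in>{\<alpha>, \<beta>, \<gamma>}. c \<alpha> *\<^sub>R \<alpha>)"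
    and sgn: "(\<forall>\<alpha>\<in>{\<alpha>, \<beta>, \<gamma>}. 0 \<le> c \<alpha>) \<or> (\<forall>\<alpha>\<in>{\<alpha>, \<beta>, \<gamma>}. c \<alpha> \<le> 0)"
    using s \<rho> unfolding simple_roots_def by force
  define e where "e = (\<lambda>x. if x = \<alpha> then c \<alpha> - p else if x = \<beta> then c \<beta> - q else c \<gamma> - r)"
  have "(\<Sum>x\<in>{\<alpha>, \<beta>, \<gamma>}. e x *\<^sub>R x) = 0"
    using c d by (simp add: e_def algebra_simps)
  then have "\<forall>x\<in>{\<alpha>, \<beta>, \<gamma>}. e x = 0"
    using ind independentD[OF ind, of "{\<alpha>, \<beta>, \<gamma>}" e] by blast
  then have "c \<alpha> = p" "c \<beta> = q" "c \<gamma> = r" using d by (simp_all add: e_def)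
  then show ?thesis using sgn by auto
qed

lemma simple_roots_perm:
  assumes "simple_roots \<Phi> xs" and "set ys = set xs" and "length ys = length xs"
  shows "simple_roots \<Phi> ys"
  using assms unfolding simple_roots_def by (metis card_distinct distinct_card)

lemma simple_roots_nonzero: "simple_roots \<Phi> \<Delta> \<Longrightarrow> \<alpha> \<in> set \<Delta> \<Longrightarrow> \<alpha> \<noteq> 0"
  using dependent_zero by (auto simp: simple_roots_def)

lemma reflection_in_root_system: "root_system \<Phi> \<Longrightarrow> \<alpha> \<in> \<Phi> \<Longrightarrow> \<rho> \<in> \<Phi> \<Longrightarrow> reflection \<alpha> \<rho> \<in> \<Phi>"
  unfolding root_system_def by blast

text \<open>Two further roots in the plane of \<alpha> and \<beta> are tested. The image of \<beta>
  under the reflection in \<alpha> has coefficient 1 at \<beta>, so its coefficient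
  \<open>- A\<close> at \<alpha> is nonnegative. Reflecting once more, in \<beta>, gives the
  coefficients \<open>- A\<close> and \<open>A * B - 1\<close>, which must again agree in
  sign.\<close>

lemma simple_roots_inner:
  assumes r: "root_system \<Phi>" and s: "simple_roots \<Phi> [\<alpha>, \<beta>, \<gamma>]"
  shows "sgn \<alpha> \<bullet> sgn \<beta> = 0 \<or> sgn \<alpha> \<bullet> sgn \<beta> \<le> - 1 / 2"
proof -
  have nz: "\<alpha> \<noteq> 0" "\<beta> \<noteq> 0" and in\<Phi>: "\<alpha> \<in> \<Phi>" "\<beta> \<in> \<Phi>"
    using simple_roots_nonzero[OF s] s by (auto simp: simple_roots_def)
  define A where "A = 2 * (\<beta> \<bullet> \<alpha>) / (\<alpha> \<bullet> \<alpha>)"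
  define B where "B = 2 * (\<beta> \<bullet> \<alpha>) / (\<beta> \<bullet> \<beta>)"
  have pos: "\<alpha> \<bullet> \<alpha> > 0" "\<beta> \<bullet> \<beta> > 0" using nz by simp_all
  have 1: "reflection \<alpha> \<beta> = (- A) *\<^sub>R \<alpha> + 1 *\<^sub>R \<beta> + 0 *\<^sub>R \<gamma>"
    by (simp add: reflection_def A_def)
  have "reflection \<alpha> \<beta> \<in> \<Phi>" using r in\<Phi> by (simp add: reflection_in_root_system)
  from simple_roots_coherent[OF s this[unfolded 1]] have A: "A \<le> 0" by simp
  \<comment> \<open>\<open>A * B\<close> is four times the squared cosine.\<close>
  have 2: "reflection \<beta> (reflection \<alpha> \<beta>) = (- A) *\<^sub>R \<alpha> + (A * B - 1) *\<^sub>R \<beta> + 0 *\<^sub>R \<gamma>"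
    using pos by (simp add: reflection_def A_def B_def inner_diff_left inner_commute algebra_simps scaleR_2 diff_divide_distrib)
  have "reflection \<beta> (reflection \<alpha> \<beta>) \<in> \<Phi>" using r in\<Phi> by (simp add: reflection_in_root_system)
  from simple_roots_coherent[OF s this[unfolded 2]] A have AB: "A = 0 \<or> 1 \<le> A * B" by auto
  define c where "c = sgn \<alpha> \<bullet> sgn \<beta>"
  have c: "c = (\<beta> \<bullet> \<alpha>) / (norm \<alpha> * norm \<beta>)"
    by (simp add: c_def sgn_div_norm inner_commute divide_simps)
  have "A * B = 4 * c\<^sup>2"
    using nz by (simp add: A_def B_def c power2_norm_eq_inner power_divide power_mult_distrib power2_eq_square dot_square_norm)
  moreover have "\<beta> \<bullet> \<alpha> \<le> 0" using A pos by (simp add: A_def divide_le_0_iff)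
  then have "c \<le> 0" by (simp add: c divide_nonpos_nonneg)
  moreover have "A = 0 \<longrightarrow> c = 0" using pos by (simp add: A_def c)
  moreover have "c \<le> - 1 / 2" if "1 \<le> 4 * c\<^sup>2" "c \<le> 0"
  proof (rule ccontr)
    assume "\<not> c \<le> - 1 / 2"
    then have "\<bar>c\<bar> < 1 / 2" using that by simp
    then have "c\<^sup>2 < (1 / 2)\<^sup>2" by (metis abs_ge_zero power2_abs power_strict_mono zero_less_numeral)
    then show False using that by (simp add: power2_eq_square)
  qed
  ultimately show ?thesis using AB unfolding c_def by auto
qed

text \<open>If \<alpha> were orthogonal to \<beta> and \<gamma>, its reflection would only negate
  the \<alpha>-coefficient of a root. The sign condition before and after leaves only multiples of
  \<alpha> and roots orthogonal to \<alpha>, which is a forbidden decomposition.\<close>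

lemma irreducible_simple_roots_not_orthogonal:
  assumes r: "root_system \<Phi>" and irr: "irreducible_roots \<Phi>" and s: "simple_roots \<Phi> [\<alpha>, \<beta>, \<gamma>]"
  shows "\<alpha> \<bullet> \<beta> \<noteq> 0 \<or> \<alpha> \<bullet> \<gamma> \<noteq> 0"
proof (rule ccontr)
  assume "\<not> ?thesis"
  then have o: "\<alpha> \<bullet> \<beta> = 0" "\<alpha> \<bullet> \<gamma> = 0" by auto
  have in\<Phi>: "\<alpha> \<in> \<Phi>" "\<beta> \<in> \<Phi>" and d: "\<alpha> \<noteq> \<beta>" "\<alpha> \<noteq> \<gamma>" "\<beta> \<noteq> \<gamma>" using s by (auto simp: simple_roots_def)
  have nz: "\<alpha> \<noteq> 0" "\<beta> \<noteq> 0" using simple_roots_nonzero[OF s] by auto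
  have split: "\<rho> \<in> span {\<alpha>} \<or> \<rho> \<bullet> \<alpha> = 0" if \<rho>: "\<rho> \<in> \<Phi>" for \<rho>
  proof -
    from s \<rho> obtain c where "\<rho> = (\<Sum>\<alpha>\<in>{\<alpha>, \<beta>, \<gamma>}. c \<alpha> *\<^sub>R \<alpha>)"
      unfolding simple_roots_def by force
    then have c: "\<rho> = c \<alpha> *\<^sub>R \<alpha> + c \<beta> *\<^sub>R \<beta> + c \<gamma> *\<^sub>R \<gamma>" using d by (simp add: add.assoc)
    have \<rho>\<alpha>: "\<rho> \<bullet> \<alpha> = c \<alpha> * (\<alpha> \<bullet> \<alpha>)"
      using o by (simp add: c inner_add_left inner_commute[of \<beta> \<alpha>] inner_commute[of \<gamma> \<alpha>])
    have 1: "reflection \<alpha> \<rho> = (- c \<alpha>) *\<^sub>R \<alpha> + c \<beta> *\<^sub>R \<beta> + c \<gamma> *\<^sub>R \<gamma>"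
    proof -
      have "reflection \<alpha> \<rho> = \<rho> - (c \<alpha> + c \<alpha>) *\<^sub>R \<alpha>" using nz \<rho>\<alpha> by (simp add: reflection_def)
      then show ?thesis unfolding c scaleR_add_left by simp
    qed
    have "reflection \<alpha> \<rho> \<in> \<Phi>" using r in\<Phi> \<rho> by (simp add: reflection_in_root_system)
    from simple_roots_coherent[OF s this[unfolded 1]] simple_roots_coherent[OF s \<rho>[unfolded c]]
    have "c \<alpha> = 0 \<or> c \<beta> = 0 \<and> c \<gamma> = 0" by linarith
    then show ?thesis
    proof
      assume "c \<alpha> = 0"
      then show ?thesis using \<rho>\<alpha> by simp
    next
      assume "c \<beta> = 0 \<and> c \<gamma> = 0"
      then show ?thesis by (simp add: c span_scale span_base)
    qed
  qed
  let ?\<Phi>1 = "\<Phi> \<inter> span {\<alpha>}" and ?\<Phi>2 = "{\<rho> \<in> \<Phi>. \<rho> \<bullet> \<alpha> = 0}"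
  have "\<Phi> = ?\<Phi>1 \<union> ?\<Phi>2" using split by blast
  moreover have "\<alpha> \<in> ?\<Phi>1" "\<beta> \<in> ?\<Phi>2"
    using in\<Phi> o by (auto simp: span_base inner_commute)
  then have "?\<Phi>1 \<noteq> {}" "?\<Phi>2 \<noteq> {}" by auto
  moreover have "\<forall>\<rho>\<in>?\<Phi>1. \<forall>\<rho>'\<in>?\<Phi>2. \<rho> \<bullet> \<rho>' = 0"
    by (auto simp: span_singleton inner_commute)
  ultimately have "\<exists>\<Phi>1 \<Phi>2. \<Phi>1 \<noteq> {} \<and> \<Phi>2 \<noteq> {} \<and> \<Phi> = \<Phi>1 \<union> \<Phi>2 \<and> (\<forall>\<alpha>\<in>\<Phi>1. \<forall>\<beta>\<in>\<Phi>2. \<alpha> \<bullet> \<beta> = 0)"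
    by (intro exI[of _ ?\<Phi>1] exI[of _ ?\<Phi>2] conjI)
  then show False using irr unfolding irreducible_roots_def by contradiction
qed

text \<open>The Coxeter diagram is a path whose middle node is the second argument. The last
  conjunct records linear independence in the form of Bessel's strict inequality.\<close>

definition path_shaped :: "'a::real_inner \<Rightarrow> 'a \<Rightarrow> 'a \<Rightarrow> bool" where
  "path_shaped \<alpha> \<beta> \<gamma> \<longleftrightarrow> sgn \<alpha> \<bullet> sgn \<gamma> = 0 \<and> sgn \<alpha> \<bullet> sgn \<beta> \<le> - 1 / 2 \<and> sgn \<beta> \<bullet> sgn \<gamma> \<le> - 1 / 2 \<and>
     (sgn \<alpha> \<bullet> sgn \<beta>)\<^sup>2 + (sgn \<beta> \<bullet> sgn \<gamma>)\<^sup>2 < 1"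

lemma sgn_inner_sgn_eq_0: "sgn \<alpha> \<bullet> sgn \<beta> = 0 \<longleftrightarrow> \<alpha> \<bullet> \<beta> = 0"
  by (auto simp: sgn_div_norm)

text \<open>By independence the part \<open>y\<close> of \<open>v\<close> orthogonal to
  \<open>u\<close> and \<open>w\<close> is nonzero, and its squared length is 1 minus the two
  squared cosines.\<close>

lemma path_shapedI:
  assumes ind: "independent {\<alpha>, \<beta>, \<gamma>}" and d: "\<alpha> \<noteq> \<beta>" "\<beta> \<noteq> \<gamma>" and "\<alpha> \<bullet> \<gamma> = 0"
    and "sgn \<alpha> \<bullet> sgn \<beta> \<le> - 1 / 2" "sgn \<beta> \<bullet> sgn \<gamma> \<le> - 1 / 2"
  shows "path_shaped \<alpha> \<beta> \<gamma>"
proof -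
  have nz: "\<alpha> \<noteq> 0" "\<beta> \<noteq> 0" "\<gamma> \<noteq> 0" using ind by (metis dependent_zero insertCI)+
  define u v w where "u = sgn \<alpha>" and "v = sgn \<beta>" and "w = sgn \<gamma>"
  have unit: "u \<bullet> u = 1" "v \<bullet> v = 1" "w \<bullet> w = 1"
    using nz by (simp_all add: u_def v_def w_def norm_sgn flip: power2_norm_eq_inner)
  have uw: "u \<bullet> w = 0" using assms by (simp add: u_def w_def sgn_inner_sgn_eq_0)
  define y where "y = v - (v \<bullet> u) *\<^sub>R u - (v \<bullet> w) *\<^sub>R w"
  have "y \<noteq> 0"
  proof
    assume "y = 0"
    then have "v = (v \<bullet> u) *\<^sub>R u + (v \<bullet> w) *\<^sub>R w" by (simp add: y_def algebra_simps)
    then have "norm \<beta> *\<^sub>R v \<in> span {\<alpha>, \<gamma>}"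
      by (metis (no_types, lifting) insertCI sgn_div_norm span_add span_base span_scale u_def w_def)
    then have "\<beta> \<in> span {\<alpha>, \<gamma>}" using nz by (simp add: v_def sgn_div_norm)
    moreover have "{\<alpha>, \<beta>, \<gamma>} - {\<beta>} = {\<alpha>, \<gamma>}" using d by auto
    ultimately show False using ind unfolding dependent_def by (metis insertCI)
  qed
  then have "0 < y \<bullet> y" by simp
  also have "y \<bullet> y = 1 - (u \<bullet> v)\<^sup>2 - (v \<bullet> w)\<^sup>2"
    using unit uw by (simp add: y_def inner_diff_left inner_diff_right inner_commute algebra_simps power2_eq_square)
  finally show ?thesis using assms uw unfolding path_shaped_def u_def v_def w_def by simp
qed

lemma irreducible_simple_roots_path_shaped:
  assumes r: "root_system \<Phi>" and irr: "irreducible_roots \<Phi>" and s: "simple_roots \<Phi> [\<alpha>, \<beta>, \<gamma>]"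
  shows "path_shaped \<alpha> \<beta> \<gamma> \<or> path_shaped \<beta> \<gamma> \<alpha> \<or> path_shaped \<gamma> \<alpha> \<beta>"
proof -
  have ind: "independent {\<alpha>, \<beta>, \<gamma>}" and d: "\<alpha> \<noteq> \<beta>" "\<alpha> \<noteq> \<gamma>" "\<beta> \<noteq> \<gamma>"
    using s by (auto simp: simple_roots_def)
  have s': "simple_roots \<Phi> [\<beta>, \<gamma>, \<alpha>]" "simple_roots \<Phi> [\<gamma>, \<alpha>, \<beta>]"
    using d by (auto intro!: simple_roots_perm[OF s])
  note inner = simple_roots_inner[OF r s] simple_roots_inner[OF r s'(1)] simple_roots_inner[OF r s'(2)]
  note conn = irreducible_simple_roots_not_orthogonal[OF r irr s]
    irreducible_simple_roots_not_orthogonal[OF r irr s'(1)] irreducible_simple_roots_not_orthogonal[OF r irr s'(2)]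
  have nz: "\<alpha> \<noteq> 0" "\<beta> \<noteq> 0" "\<gamma> \<noteq> 0" using simple_roots_nonzero[OF s] by auto
  have "\<alpha> \<bullet> \<beta> = 0 \<or> \<beta> \<bullet> \<gamma> = 0 \<or> \<gamma> \<bullet> \<alpha> = 0"
  proof (rule ccontr)
    assume "\<not> ?thesis"
    then have le: "sgn \<alpha> \<bullet> sgn \<beta> \<le> - 1 / 2" "sgn \<beta> \<bullet> sgn \<gamma> \<le> - 1 / 2" "sgn \<gamma> \<bullet> sgn \<alpha> \<le> - 1 / 2"
      using inner by (auto simp: sgn_inner_sgn_eq_0)
    have unit: "sgn \<alpha> \<bullet> sgn \<alpha> = 1" "sgn \<beta> \<bullet> sgn \<beta> = 1" "sgn \<gamma> \<bullet> sgn \<gamma> = 1"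
      using nz by (simp_all add: norm_sgn flip: power2_norm_eq_inner)
    let ?y = "sgn \<alpha> + sgn \<beta> + sgn \<gamma>"
    \<comment> \<open>The squared length is 3 plus twice the sum of three cosines, each at most
      \<open>- 1 / 2\<close>.\<close>
    have "?y \<bullet> ?y \<le> 0" using le unit by (simp add: inner_add_left inner_add_right inner_commute)
    then have y: "?y = 0" by (metis inner_gt_zero_iff not_less)
    define e where "e = (\<lambda>x. inverse (norm (x :: 'a)))"
    have "(\<Sum>x\<in>{\<alpha>, \<beta>, \<gamma>}. e x *\<^sub>R x) = 0" using y d by (simp add: e_def sgn_div_norm add.assoc)
    then have "e \<alpha> = 0" using independentD[OF ind, of "{\<alpha>, \<beta>, \<gamma>}" e] by blast
    then show False using nz by (simp add: e_def)
  qed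
  then consider "\<gamma> \<bullet> \<alpha> = 0" | "\<alpha> \<bullet> \<beta> = 0" | "\<beta> \<bullet> \<gamma> = 0" by blast
  then show ?thesis
  proof cases
    case 1
    then have "path_shaped \<alpha> \<beta> \<gamma>"
      using inner conn ind d by (intro path_shapedI) (auto simp: inner_commute sgn_inner_sgn_eq_0)
    then show ?thesis by blast
  next
    case 2
    then have "path_shaped \<beta> \<gamma> \<alpha>"
      using inner conn ind d by (intro path_shapedI) (auto simp: inner_commute sgn_inner_sgn_eq_0 insert_commute)
    then show ?thesis by blast
  next
    case 3
    then have "path_shaped \<gamma> \<alpha> \<beta>"
      using inner conn ind d by (intro path_shapedI) (auto simp: inner_commute sgn_inner_sgn_eq_0 insert_commute)
    then show ?thesis by blast
  qed
qed

lemma sgn_combination_coherent: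
  assumes s: "simple_roots \<Phi> [\<alpha>, \<beta>, \<gamma>]" and "c > 0"
    and \<rho>: "c *\<^sub>R (x *\<^sub>R sgn \<alpha> + y *\<^sub>R sgn \<beta> + z *\<^sub>R sgn \<gamma>) \<in> \<Phi>"
  shows "0 \<le> x \<and> 0 \<le> y \<and> 0 \<le> z \<or> x \<le> 0 \<and> y \<le> 0 \<and> z \<le> 0"
proof -
  have pos: "norm \<alpha> > 0" "norm \<beta> > 0" "norm \<gamma> > 0" using simple_roots_nonzero[OF s] by auto
  have "(c * x / norm \<alpha>) *\<^sub>R \<alpha> + (c * y / norm \<beta>) *\<^sub>R \<beta> + (c * z / norm \<gamma>) *\<^sub>R \<gamma> \<in> \<Phi>"
    using \<rho> by (simp add: sgn_div_norm scaleR_add_right divide_inverse mult.assoc)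
  from simple_roots_coherent[OF s this] show ?thesis
    using pos \<open>c > 0\<close> by (simp add: zero_le_divide_iff divide_le_0_iff zero_le_mult_iff mult_le_0_iff not_less)
qed

text \<open>The squared cosines with the simple roots determine the direction of \<rho> up to
  finitely many candidates. For each of them \<rho> or one of two reflected copies has simple-root
  coefficients of both signs.\<close>

lemma no_root_at_45_degrees_to_A3:
  assumes r: "root_system \<Phi>" and s: "simple_roots \<Phi> [\<alpha>, \<beta>, \<gamma>]" and \<rho>: "\<rho> \<in> \<Phi>"
    and angles: "sgn \<alpha> \<bullet> sgn \<gamma> = 0" "sgn \<alpha> \<bullet> sgn \<beta> = - 1 / 2" "sgn \<beta> \<bullet> sgn \<gamma> = - 1 / 2"
    and half: "\<And>\<delta>. \<delta> \<in> {\<alpha>, \<beta>, \<gamma>} \<Longrightarrow> (sgn \<rho> \<bullet> sgn \<delta>)\<^sup>2 \<in> {0, 1 / 2}"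
  shows False
proof -
  define u v w where "u = sgn \<alpha>" and "v = sgn \<beta>" and "w = sgn \<gamma>"
  have nz: "\<alpha> \<noteq> 0" "\<beta> \<noteq> 0" "\<gamma> \<noteq> 0" using simple_roots_nonzero[OF s] by auto
  have "\<rho> \<noteq> 0" using \<rho> r by (auto simp: root_system_def)
  have in\<Phi>: "\<alpha> \<in> \<Phi>" "\<beta> \<in> \<Phi>" "\<gamma> \<in> \<Phi>" and d: "\<alpha> \<noteq> \<beta>" "\<alpha> \<noteq> \<gamma>" "\<beta> \<noteq> \<gamma>"
    using s by (auto simp: simple_roots_def)
  have unit: "u \<bullet> u = 1" "v \<bullet> v = 1" "w \<bullet> w = 1"
    using nz by (simp_all add: u_def v_def w_def norm_sgn flip: power2_norm_eq_inner)
  have uvw: "u \<bullet> w = 0" "w \<bullet> u = 0" "u \<bullet> v = - 1 / 2" "v \<bullet> u = - 1 / 2" "v \<bullet> w = - 1 / 2" "w \<bullet> v = - 1 / 2"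
    using angles by (simp_all add: u_def v_def w_def inner_commute)
  define n where "n = norm \<rho>"
  have "n > 0" using \<open>\<rho> \<noteq> 0\<close> by (simp add: n_def)
  from s \<rho> obtain c where "\<rho> = (\<Sum>\<alpha>\<in>{\<alpha>, \<beta>, \<gamma>}. c \<alpha> *\<^sub>R \<alpha>)"
    unfolding simple_roots_def by force
  then have c: "\<rho> = c \<alpha> *\<^sub>R \<alpha> + c \<beta> *\<^sub>R \<beta> + c \<gamma> *\<^sub>R \<gamma>" using d by (simp add: add.assoc)
  define x y z where "x = c \<alpha> * norm \<alpha> / n" and "y = c \<beta> * norm \<beta> / n" and "z = c \<gamma> * norm \<gamma> / n"
  have \<rho>_eq: "\<rho> = n *\<^sub>R (x *\<^sub>R u + y *\<^sub>R v + z *\<^sub>R w)"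
  proof -
    have "norm \<alpha> *\<^sub>R u = \<alpha>" "norm \<beta> *\<^sub>R v = \<beta>" "norm \<gamma> *\<^sub>R w = \<gamma>"
      using nz by (simp_all add: u_def v_def w_def sgn_div_norm)
    moreover have "n * x = c \<alpha> * norm \<alpha>" "n * y = c \<beta> * norm \<beta>" "n * z = c \<gamma> * norm \<gamma>"
      using \<open>n > 0\<close> by (simp_all add: x_def y_def z_def)
    ultimately show ?thesis by (simp add: c scaleR_add_right) (metis scaleR_scaleR)
  qed
  define e where "e = x *\<^sub>R u + y *\<^sub>R v + z *\<^sub>R w"
  have "e = inverse n *\<^sub>R \<rho>" using \<open>n > 0\<close> unfolding \<rho>_eq e_def by simp
  then have e: "e = sgn \<rho>" by (simp add: sgn_div_norm n_def)
  have eu: "e \<bullet> u = x - y / 2" and ev: "e \<bullet> v = y - x / 2 - z / 2" and ew: "e \<bullet> w = z - y / 2"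
    unfolding e_def by (simp_all add: inner_add_left unit uvw)
  have "e \<bullet> e = 1" using \<open>\<rho> \<noteq> 0\<close> by (simp add: e norm_sgn flip: power2_norm_eq_inner)
  moreover have "e \<bullet> e = x * (e \<bullet> u) + y * (e \<bullet> v) + z * (e \<bullet> w)"
    using inner_add_right[of e] by (simp add: e_def)
  ultimately have norm: "x * (x - y / 2) + y * (y - x / 2 - z / 2) + z * (z - y / 2) = 1"
    unfolding eu ev ew by simp
  have sq: "(x - y / 2)\<^sup>2 \<in> {0, 1 / 2}" "(y - x / 2 - z / 2)\<^sup>2 \<in> {0, 1 / 2}" "(z - y / 2)\<^sup>2 \<in> {0, 1 / 2}"
    using half[of \<alpha>] half[of \<beta>] half[of \<gamma>] unfolding eu[symmetric] ev[symmetric] ew[symmetric]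
    by (simp_all add: e u_def v_def w_def)
  note coh = sgn_combination_coherent[OF s \<open>n > 0\<close>, folded u_def v_def w_def]
  have \<alpha>: "reflection \<alpha> u = - u" "reflection \<alpha> v = v + u" "reflection \<alpha> w = w"
    unfolding reflection_sgn[symmetric, of \<alpha>] u_def[symmetric]
    by (simp_all add: reflection_def unit uvw scaleR_2)
  have \<beta>: "reflection \<beta> u = u + v" "reflection \<beta> v = - v" "reflection \<beta> w = w + v"
    unfolding reflection_sgn[symmetric, of \<beta>] v_def[symmetric]
    by (simp_all add: reflection_def unit uvw scaleR_2)
  have su: "reflection \<alpha> (n *\<^sub>R (a *\<^sub>R u + b *\<^sub>R v + d *\<^sub>R w)) = n *\<^sub>R ((b - a) *\<^sub>R u + b *\<^sub>R v + d *\<^sub>R w)" for a b d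
    by (simp add: linear_add[OF linear_reflection] linear_scale[OF linear_reflection] \<alpha> algebra_simps)
  have sv: "reflection \<beta> (n *\<^sub>R (a *\<^sub>R u + b *\<^sub>R v + d *\<^sub>R w)) = n *\<^sub>R (a *\<^sub>R u + (a + d - b) *\<^sub>R v + d *\<^sub>R w)" for a b d
    by (simp add: linear_add[OF linear_reflection] linear_scale[OF linear_reflection] \<beta> algebra_simps)
  \<comment> \<open>These are \<rho>, its reflection in \<alpha>, and its reflection first in
    \<beta> and then in \<alpha>.\<close>
  have roots: "n *\<^sub>R (x *\<^sub>R u + y *\<^sub>R v + z *\<^sub>R w) \<in> \<Phi>"
    "n *\<^sub>R ((y - x) *\<^sub>R u + y *\<^sub>R v + z *\<^sub>R w) \<in> \<Phi>"
    "n *\<^sub>R ((x + z - y - x) *\<^sub>R u + (x + z - y) *\<^sub>R v + z *\<^sub>R w) \<in> \<Phi>"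
    using reflection_in_root_system[OF r] in\<Phi> \<rho> unfolding \<rho>_eq by (metis su sv)+
  note coherent = coh[OF roots(1)] coh[OF roots(2)] coh[OF roots(3)]
  define h where "h = sqrt (1 / 2)"
  have h: "h > 0" "h * h = 1 / 2" by (simp_all add: h_def)
  have cases: "t = 0 \<or> t = h \<or> t = - h" if "t\<^sup>2 \<in> {0, 1 / 2}" for t
  proof -
    have "t\<^sup>2 = 0 \<or> t\<^sup>2 = h\<^sup>2" using that h by (auto simp: power2_eq_square)
    then show ?thesis by (auto simp: power2_eq_iff)
  qed
  define p q r' where "p = x - y / 2" and "q = y - x / 2 - z / 2" and "r' = z - y / 2"
  have xyz: "y = p + 2 * q + r'" "x = p + y / 2" "z = r' + y / 2" by (simp_all add: p_def q_def r'_def)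
  have N: "2 * p\<^sup>2 + 2 * r'\<^sup>2 + (p + 2 * q + r')\<^sup>2 = 2"
    using norm by (simp add: p_def q_def r'_def power2_eq_square algebra_simps)
  \<comment> \<open>Among these values \<open>N\<close> leaves, up to a common sign,
    \<open>(0, h, 0)\<close>, \<open>(h, - h, h)\<close> and \<open>(h, 0, - h)\<close> for
    \<open>(p, q, r')\<close>. They violate the third, second and first fact in
    \<open>coherent\<close>, respectively.\<close>
  have "p = 0 \<or> p = h \<or> p = - h" "q = 0 \<or> q = h \<or> q = - h" "r' = 0 \<or> r' = h \<or> r' = - h"
    unfolding p_def q_def r'_def by (fact cases[OF sq(1)] cases[OF sq(2)] cases[OF sq(3)])+
  then show False
    using N coherent h unfolding xyz
    by (elim disjE) (simp_all add: power2_eq_square algebra_simps)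
qed

section \<open>Mirrors of the tetrahedron and the octahedron\<close>

lemma reflection_orthogonal_transformation:
  assumes "orthogonal_transformation Q"
  shows "reflection (Q a) (Q x) = Q (reflection a x)"
proof -
  have "linear Q" and "\<And>x y. Q x \<bullet> Q y = x \<bullet> y" using assms by (auto simp: orthogonal_transformation_def)
  then show ?thesis by (simp add: reflection_def linear_diff linear_scale)
qed

text \<open>Conjugation by \<open>Q\<close> moves the question to the polyhedron in standard
  position, where the possible mirrors can be listed in coordinates.\<close>

lemma reflection_group_root:
  fixes Q :: "'a::euclidean_space \<Rightarrow> 'a"
  assumes Q: "orthogonal_transformation Q" and g: "reflection_group \<Phi> = symmetry_group (Q ` V)"
    and "\<alpha> \<in> \<Phi>"
  obtains a where "\<alpha> = Q a" "reflection a ` V = V"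
proof -
  have "surj Q" by (rule orthogonal_transformation_surj[OF Q])
  then obtain a where a: "\<alpha> = Q a" by blast
  have "reflection \<alpha> \<in> reflection_group \<Phi>"
    unfolding reflection_group_def using \<open>\<alpha> \<in> \<Phi>\<close> by (intro generate.incl) blast
  then have "reflection \<alpha> ` Q ` V = Q ` V" by (simp add: g symmetry_group_def)
  then have "Q ` reflection a ` V = Q ` V"
    by (simp add: a image_image reflection_orthogonal_transformation[OF Q])
  then have "reflection a ` V = V"
    using orthogonal_transformation_inj[OF Q] by (simp add: inj_image_eq_iff)
  then show ?thesis using that a by blast
qed

text \<open>For \<open>m \<noteq> 0\<close> this says that \<open>a\<close> is a multiple of \<open>m\<close>, in a form that can be checked by
  computing with coordinates.\<close>

definition along :: "'a::real_inner \<Rightarrow> 'a \<Rightarrow> bool" where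
  "along a m \<longleftrightarrow> (m \<bullet> m) *\<^sub>R a = (a \<bullet> m) *\<^sub>R m"

lemma along_scaleR: "along a m \<Longrightarrow> along (c *\<^sub>R a) m"
  unfolding along_def by (metis inner_scaleR_left scaleR_left_commute scaleR_scaleR)

lemma alongE:
  assumes "along a m" "m \<noteq> 0"
  obtains k where "a = k *\<^sub>R m"
proof
  have "inverse (m \<bullet> m) *\<^sub>R (m \<bullet> m) *\<^sub>R a = inverse (m \<bullet> m) *\<^sub>R (a \<bullet> m) *\<^sub>R m"
    using assms(1) by (simp add: along_def)
  then show "a = (inverse (m \<bullet> m) * (a \<bullet> m)) *\<^sub>R m" using assms(2) by simp
qed

text \<open>A reflection moves every point by a multiple of its root, so a single moved vertex and
  its image reveal the direction of the root.\<close>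

lemma along_difference:
  assumes "reflection a v \<noteq> v" "along (v - reflection a v) m"
  shows "along a m"
proof -
  define k where "k = 2 * (v \<bullet> a) / (a \<bullet> a)"
  have d: "v - reflection a v = k *\<^sub>R a" by (simp add: reflection_def k_def)
  then have "k \<noteq> 0" using assms(1) by auto
  then have "a = inverse k *\<^sub>R (v - reflection a v)" by (simp add: d)
  then show ?thesis using along_scaleR[OF assms(2)] by metis
qed

text \<open>Squared cosines depend neither on the lengths nor the signs of the vectors nor on
  \<open>Q\<close>, so they can be read off from a finite list of normals.\<close>

lemma sgn_inner_along:
  assumes Q: "orthogonal_transformation Q" and a: "along a m" "Q a \<noteq> 0" and b: "along b m'" "Q b \<noteq> 0"
    and m: "m \<noteq> 0" "m' \<noteq> 0"
  shows "(sgn (Q a) \<bullet> sgn (Q b))\<^sup>2 = (m \<bullet> m')\<^sup>2 / ((m \<bullet> m) * (m' \<bullet> m'))"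
proof -
  obtain k where k: "a = k *\<^sub>R m" using alongE[OF a(1) m(1)] .
  obtain l where l: "b = l *\<^sub>R m'" using alongE[OF b(1) m(2)] .
  have lin: "linear Q" and inner: "\<And>x y. Q x \<bullet> Q y = x \<bullet> y"
    using Q by (auto simp: orthogonal_transformation_def)
  have "k \<noteq> 0" "l \<noteq> 0" using a(2) b(2) k l linear_0[OF lin] by auto
  have "sgn (Q a) \<bullet> sgn (Q b) = (a \<bullet> b) / (norm (Q a) * norm (Q b))"
    by (simp add: sgn_div_norm inner divide_simps)
  then have "(sgn (Q a) \<bullet> sgn (Q b))\<^sup>2 = (a \<bullet> b)\<^sup>2 / ((a \<bullet> a) * (b \<bullet> b))"
    by (simp add: power_divide power_mult_distrib power2_norm_eq_inner inner)
  then show ?thesis using \<open>k \<noteq> 0\<close> \<open>l \<noteq> 0\<close> by (simp add: k l power2_eq_square)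
qed

lemma inner_real3: "(x::real^3) \<bullet> y = x $ 1 * y $ 1 + x $ 2 * y $ 2 + x $ 3 * y $ 3"
  by (simp add: inner_vec_def sum_3)

lemma vector3_eq_iff: "(x::real^3) = y \<longleftrightarrow> x $ 1 = y $ 1 \<and> x $ 2 = y $ 2 \<and> x $ 3 = y $ 3"
  by (simp add: vec_eq_iff forall_3)

text \<open>The standard roots of \<open>A\<^sub>3\<close> up to sign; adding
  \<open>axis_normals\<close> gives those of \<open>B\<^sub>3\<close>.\<close>

definition edge_normals :: "(real^3) set" where
  "edge_normals = {vector [0, 1, 1], vector [0, 1, - 1], vector [1, 0, 1], vector [1, 0, - 1],
     vector [1, 1, 0], vector [1, - 1, 0]}"

definition axis_normals :: "(real^3) set" where
  "axis_normals = {vector [1, 0, 0], vector [0, 1, 0], vector [0, 0, 1]}"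

lemma tetrahedron_mirror:
  assumes V: "reflection a ` tetrahedron = tetrahedron" and "a \<noteq> 0"
  obtains m where "m \<in> edge_normals" "along a m"
proof -
  have "\<exists>v\<in>tetrahedron. v \<bullet> a \<noteq> 0"
    using \<open>a \<noteq> 0\<close> by (auto simp: tetrahedron_def inner_real3 vector3_eq_iff)
  then obtain v where v: "v \<in> tetrahedron" "reflection a v \<noteq> v"
    using \<open>a \<noteq> 0\<close> by (auto simp: reflection_def)
  have "\<forall>v\<in>tetrahedron. \<forall>w\<in>tetrahedron. w \<noteq> v \<longrightarrow> (\<exists>m\<in>edge_normals. along (v - w) m)"
    by (simp add: tetrahedron_def edge_normals_def along_def inner_real3 vector3_eq_iff)
      (rule exI[of _ "vector [1, - 1, 0]"], simp)
  then obtain m where "m \<in> edge_normals" "along (v - reflection a v) m" using v V by blast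
  then show ?thesis using that along_difference v by blast
qed

lemma octahedron_mirror:
  assumes V: "reflection a ` octahedron = octahedron" and "a \<noteq> 0"
  obtains m where "m \<in> edge_normals \<union> axis_normals" "along a m"
proof -
  have "\<exists>v\<in>octahedron. v \<bullet> a \<noteq> 0"
    using \<open>a \<noteq> 0\<close> by (auto simp: octahedron_def inner_real3 vector3_eq_iff)
  then obtain v where v: "v \<in> octahedron" "reflection a v \<noteq> v"
    using \<open>a \<noteq> 0\<close> by (auto simp: reflection_def)
  have "\<forall>v\<in>octahedron. \<forall>w\<in>octahedron. w \<noteq> v \<longrightarrow> (\<exists>m\<in>edge_normals \<union> axis_normals. along (v - w) m)"
    by (simp add: octahedron_def edge_normals_def axis_normals_def along_def inner_real3 vector3_eq_iff)
      (rule exI[of _ "vector [1, - 1, 0]"], simp)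
  then obtain m where "m \<in> edge_normals \<union> axis_normals" "along (v - reflection a v) m" using v V by blast
  then show ?thesis using that along_difference v by blast
qed

lemma edge_normals_inner:
  assumes "m \<in> edge_normals" "m' \<in> edge_normals"
  shows "m \<bullet> m = 2" "(m \<bullet> m')\<^sup>2 \<in> {0, 1, 4}"
  using assms by (auto simp: edge_normals_def inner_real3)

lemma axis_normals_inner:
  assumes "m \<in> axis_normals"
  shows "m \<bullet> m = 1" "m' \<in> axis_normals \<Longrightarrow> (m \<bullet> m')\<^sup>2 \<in> {0, 1}" "m' \<in> edge_normals \<Longrightarrow> (m \<bullet> m')\<^sup>2 \<in> {0, 1}"
  using assms by (auto simp: axis_normals_def edge_normals_def inner_real3)

text \<open>The group generated by these reflections does not contain \<open>- 1\<close>.\<close>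

lemma edge_reflection_prod:
  assumes "m \<in> edge_normals"
  shows "reflection m x $ 1 * reflection m x $ 2 * reflection m x $ 3 = x $ 1 * x $ 2 * x $ 3"
proof -
  \<comment> \<open>So the reflection swaps two coordinates and changes the signs of both or of
    neither.\<close>
  have "reflection m x = x - (x \<bullet> m) *\<^sub>R m"
    using edge_normals_inner(1)[OF assms assms] by (simp add: reflection_def)
  then show ?thesis using assms by (auto simp: edge_normals_def inner_real3)
qed

text \<open>If no root lay along an axis, every root would lie along an edge normal, and the group
  would preserve the product of the coordinates. But \<open>- 1\<close> is a symmetry of the
  octahedron and negates that product.\<close>

lemma octahedron_axis_root:
  fixes Q :: "real^3 \<Rightarrow> real^3"
  assumes Q: "orthogonal_transformation Q" and g: "reflection_group \<Phi> = symmetry_group (Q ` octahedron)"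
    and "0 \<notin> \<Phi>"
  obtains a m where "Q a \<in> \<Phi>" "m \<in> axis_normals" "along a m"
proof (rule ccontr)
  note witness = that
  assume "\<not> thesis"
  then have no: "\<not> along a m" if "Q a \<in> \<Phi>" "m \<in> axis_normals" for a m
    using that witness by blast
  have lin: "linear Q" and inj: "inj Q" and surj: "surj Q"
    using Q by (rule orthogonal_transformation_linear orthogonal_transformation_inj orthogonal_transformation_surj)+
  define P :: "real^3 \<Rightarrow> real" where "P = (\<lambda>x. x $ 1 * x $ 2 * x $ 3)"
  have refl: "\<exists>z. reflection \<alpha> (Q y) = Q z \<and> P z = P y" if \<alpha>: "\<alpha> \<in> \<Phi>" for \<alpha> y
  proof -
    obtain a where a: "\<alpha> = Q a" "reflection a ` octahedron = octahedron"
      using reflection_group_root[OF Q g \<alpha>] .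
    have "a \<noteq> 0" using a \<open>0 \<notin> \<Phi>\<close> \<alpha> linear_0[OF lin] by auto
    then obtain m where m: "m \<in> edge_normals \<union> axis_normals" "along a m" using octahedron_mirror[OF a(2)] by blast
    then have me: "m \<in> edge_normals" using no a \<alpha> by blast
    then have "m \<noteq> 0" using edge_normals_inner(1) by force
    then obtain k where "a = k *\<^sub>R m" using alongE m by blast
    with \<open>a \<noteq> 0\<close> have "reflection a = reflection m" by (simp add: reflection_scaleR_root)
    then have "reflection \<alpha> (Q y) = Q (reflection m y)"
      by (simp add: a reflection_orthogonal_transformation[OF Q])
    then show ?thesis using edge_reflection_prod[OF me] unfolding P_def by blast
  qed
  \<comment> \<open>The invariant is expressed in the coordinates before \<open>Q\<close>.
    Bijectivity is carried along because multiplication in \<open>BijGroup\<close> is composition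
    only for bijections.\<close>
  have inv: "bij f \<and> (\<forall>y. \<exists>z. f (Q y) = Q z \<and> P z = P y)" if "f \<in> reflection_group \<Phi>" for f
    using that unfolding reflection_group_def
  proof (induction rule: generate.induct)
    case one
    show ?case unfolding one_BijGroup by (intro conjI allI bij_id) auto
  next
    case (incl h)
    then show ?case using refl by (auto simp: reflection_bij)
  next
    case (inv h)
    then show ?case using refl by (auto simp: inv_reflection_BijGroup reflection_bij)
  next
    case (eng h1 h2)
    then have comp: "h1 \<otimes>\<^bsub>BijGroup UNIV\<^esub> h2 = h1 \<circ> h2" and "bij (h1 \<circ> h2)"
      by (auto intro: mult_BijGroup bij_comp)
    moreover have "\<exists>z. (h1 \<circ> h2) (Q y) = Q z \<and> P z = P y" for y
      using eng.IH by (metis comp_apply)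
    ultimately show ?case unfolding comp by blast
  qed
  have "- x \<in> octahedron" if "x \<in> octahedron" for x
    using that by (auto simp: octahedron_def vector3_eq_iff)
  then have "uminus ` octahedron = octahedron" by (force simp: image_iff intro: bexI[of _ "- x" for x])
  moreover have "uminus ` Q ` octahedron = Q ` uminus ` octahedron"
    by (simp add: image_image linear_neg[OF lin])
  ultimately have "uminus ` Q ` octahedron = Q ` octahedron" by simp
  moreover have "orthogonal_transformation (uminus :: real^3 \<Rightarrow> real^3)"
    by (simp add: orthogonal_transformation_def linear_iff)
  ultimately have "uminus \<in> reflection_group \<Phi>" by (simp add: g symmetry_group_def)
  \<comment> \<open>Here \<open>1\<close> is the vector with all coordinates 1, at which the product
    does not vanish.\<close>
  from inv[OF this] obtain z where "- Q 1 = Q z" "P z = P 1" by blast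
  then have "z = - 1" using inj lin by (metis injD linear_neg)
  then show False using \<open>P z = P 1\<close> by (simp add: P_def)
qed

section \<open>Mirrors of the icosahedron\<close>

definition phi :: real where "phi = (1 + sqrt 5) / 2"

lemma phi_square: "phi * phi = phi + 1"
  by (simp add: phi_def field_simps)

lemma phi_square_left: "phi * (phi * x) = phi * x + x"
  by (simp add: phi_square distrib_right flip: mult.assoc)

lemma phi_bounds: "3 / 2 < phi" "phi < 2"
proof -
  have "2 < sqrt 5" by (rule real_less_rsqrt) simp
  then show "3 / 2 < phi" by (simp add: phi_def)
  have "sqrt 5 < 3" by (rule real_less_lsqrt) simp_all
  then show "phi < 2" by (simp add: phi_def)
qed

text \<open>At \<open>pi / 5\<close> the sines of the double and the triple angle agree. Dividing by
  the sine leaves a quadratic equation for the cosine, whose only positive root is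
  \<open>phi / 2\<close>.\<close>

lemma cos_pi_5: "cos (pi / 5) = phi / 2"
proof -
  define c s where "c = cos (pi / 5)" and "s = sin (pi / 5)"
  have "s > 0" unfolding s_def by (rule sin_gt_zero) simp_all
  have "c > 0" unfolding c_def by (rule cos_gt_zero) simp_all
  have sc: "s\<^sup>2 = 1 - c\<^sup>2" by (simp add: s_def c_def sin_squared_eq)
  have "3 * (pi / 5) = pi - 2 * (pi / 5)" by simp
  then have "sin (3 * (pi / 5)) = sin (2 * (pi / 5))" by (metis sin_pi_minus)
  moreover have "sin (3 * (pi / 5)) = sin (2 * (pi / 5) + pi / 5)" by simp
  ultimately have "2 * s * c * c + (c\<^sup>2 - s\<^sup>2) * s = 2 * s * c"
    unfolding sin_add sin_double cos_double by (simp add: s_def c_def)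
  then have "s * (4 * c\<^sup>2 - 2 * c - 1) = 0" unfolding sc by (simp add: algebra_simps power2_eq_square)
  then have "4 * c\<^sup>2 - 2 * c - 1 = 0" using \<open>s > 0\<close> by simp
  then have "(2 * c - phi) * (2 * c + phi - 1) = 0"
    using phi_square by (simp add: algebra_simps power2_eq_square)
  moreover have "2 * c + phi - 1 > 0" using \<open>c > 0\<close> phi_bounds by simp
  ultimately show ?thesis unfolding c_def by simp
qed

text \<open>Exact coordinates: the pair \<open>(a, b)\<close> of integers stands for \<open>a + b \<phi>\<close>.\<close>

type_synonym zphi = "int \<times> int"

fun zplus :: "zphi \<Rightarrow> zphi \<Rightarrow> zphi" where "zplus (a, b) (c, d) = (a + c, b + d)"
fun zminus :: "zphi \<Rightarrow> zphi \<Rightarrow> zphi" where "zminus (a, b) (c, d) = (a - c, b - d)"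
fun ztimes :: "zphi \<Rightarrow> zphi \<Rightarrow> zphi" where "ztimes (a, b) (c, d) = (a * c + b * d, a * d + b * c + b * d)"
fun zreal :: "zphi \<Rightarrow> real" where "zreal (a, b) = of_int a + of_int b * phi"

lemma zreal_simps:
  "zreal (zplus p q) = zreal p + zreal q"
  "zreal (zminus p q) = zreal p - zreal q"
  "zreal (ztimes p q) = zreal p * zreal q"
  by (cases p; cases q; simp add: algebra_simps phi_square_left)+

type_synonym zvec = "zphi \<times> zphi \<times> zphi"

fun zvec :: "zvec \<Rightarrow> real^3" where "zvec (p, q, r) = vector [zreal p, zreal q, zreal r]"
fun zdot :: "zvec \<Rightarrow> zvec \<Rightarrow> zphi" where
  "zdot (p, q, r) (p', q', r') = zplus (ztimes p p') (zplus (ztimes q q') (ztimes r r'))"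
fun zscale :: "zphi \<Rightarrow> zvec \<Rightarrow> zvec" where
  "zscale k (p, q, r) = (ztimes k p, ztimes k q, ztimes k r)"
fun zdiff :: "zvec \<Rightarrow> zvec \<Rightarrow> zvec" where
  "zdiff (p, q, r) (p', q', r') = (zminus p p', zminus q q', zminus r r')"
fun zdet :: "zvec \<Rightarrow> zvec \<Rightarrow> zvec \<Rightarrow> zphi" where
  "zdet (p, q, r) (p', q', r') (p'', q'', r'') =
     zplus (ztimes p (zminus (ztimes q' r'') (ztimes r' q'')))
    (zplus (ztimes q (zminus (ztimes r' p'') (ztimes p' r'')))
           (ztimes r (zminus (ztimes p' q'') (ztimes q' p''))))"

lemma zvec_inner: "zvec x \<bullet> zvec y = zreal (zdot x y)"
  by (cases x rule: prod_cases3; cases y rule: prod_cases3) (simp add: inner_real3 zreal_simps)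

lemma zvec_scale: "zvec (zscale k x) = zreal k *\<^sub>R zvec x"
  by (cases x rule: prod_cases3) (simp add: vector3_eq_iff zreal_simps)

lemma zvec_diff: "zvec (zdiff x y) = zvec x - zvec y"
  by (cases x rule: prod_cases3; cases y rule: prod_cases3) (simp add: vector3_eq_iff zreal_simps)

text \<open>The square of a determinant is the Gram determinant of its rows, here expanded in
  coordinates.\<close>

lemma gram_det3:
  fixes x1 :: real
  shows "(x1 * (y2 * z3 - y3 * z2) + (x2 * (y3 * z1 - y1 * z3) + x3 * (y1 * z2 - y2 * z1)))\<^sup>2 =
    (x1 * x1 + x2 * x2 + x3 * x3) * (y1 * y1 + y2 * y2 + y3 * y3) * (z1 * z1 + z2 * z2 + z3 * z3)
    + 2 * (x1 * y1 + x2 * y2 + x3 * y3) * (y1 * z1 + y2 * z2 + y3 * z3) * (x1 * z1 + x2 * z2 + x3 * z3)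
    - (x1 * x1 + x2 * x2 + x3 * x3) * (y1 * z1 + y2 * z2 + y3 * z3)\<^sup>2
    - (y1 * y1 + y2 * y2 + y3 * y3) * (x1 * z1 + x2 * z2 + x3 * z3)\<^sup>2
    - (z1 * z1 + z2 * z2 + z3 * z3) * (x1 * y1 + x2 * y2 + x3 * y3)\<^sup>2"
  by (simp add: algebra_simps power2_eq_square)

text \<open>Lengths and angles alone fix the right-hand side, while the left-hand side must be a
  square in the ring generated by \<open>phi\<close>. This is the arithmetic obstruction to type
  \<open>A\<^sub>3\<close> among the icosahedral mirrors.\<close>

lemma zdet_square:
  "(zreal (zdet x y z))\<^sup>2 =
    (zvec x \<bullet> zvec x) * (zvec y \<bullet> zvec y) * (zvec z \<bullet> zvec z)
    + 2 * (zvec x \<bullet> zvec y) * (zvec y \<bullet> zvec z) * (zvec x \<bullet> zvec z)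
    - (zvec x \<bullet> zvec x) * (zvec y \<bullet> zvec z)\<^sup>2
    - (zvec y \<bullet> zvec y) * (zvec x \<bullet> zvec z)\<^sup>2
    - (zvec z \<bullet> zvec z) * (zvec x \<bullet> zvec y)\<^sup>2"
proof -
  have "zreal (zdet x y z) = zvec x $ 1 * (zvec y $ 2 * zvec z $ 3 - zvec y $ 3 * zvec z $ 2)
      + (zvec x $ 2 * (zvec y $ 3 * zvec z $ 1 - zvec y $ 1 * zvec z $ 3)
       + zvec x $ 3 * (zvec y $ 1 * zvec z $ 2 - zvec y $ 2 * zvec z $ 1))"
    by (cases x rule: prod_cases3; cases y rule: prod_cases3; cases z rule: prod_cases3) (simp add: zreal_simps)
  then show ?thesis unfolding inner_real3 by (simp only: gram_det3)
qed

text \<open>The order matters: the first three vertices form a face, and \<open>take 3\<close>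
  selects them below.\<close>

definition icosahedron_vertices :: "zvec list" where
  "icosahedron_vertices =
    [((0, 0), (1, 0), (0, 1)), ((1, 0), (0, 1), (0, 0)), ((0, 1), (0, 0), (1, 0)),
     ((0, 0), (1, 0), (0, - 1)), ((1, 0), (0, - 1), (0, 0)), ((0, - 1), (0, 0), (1, 0)),
     ((0, 0), (- 1, 0), (0, 1)), ((- 1, 0), (0, 1), (0, 0)), ((0, 1), (0, 0), (- 1, 0)),
     ((0, 0), (- 1, 0), (0, - 1)), ((- 1, 0), (0, - 1), (0, 0)), ((0, - 1), (0, 0), (- 1, 0))]"

text \<open>The standard roots of \<open>H\<^sub>3\<close>, one for each of the 15 mirrors, scaled
  to length 2 so that all coordinates are integral combinations of 1 and \<open>phi\<close>. Note
  that \<open>phi - 1\<close> is the inverse of \<open>phi\<close>.\<close>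

definition icosahedron_normals :: "zvec list" where
  "icosahedron_normals =
    [((2, 0), (0, 0), (0, 0)), ((0, 0), (2, 0), (0, 0)), ((0, 0), (0, 0), (2, 0))] @
    [((1, 0), (s * - 1, s * 1), (0, t)). s \<leftarrow> [1, - 1], t \<leftarrow> [1, - 1]] @
    [((0, t), (1, 0), (s * - 1, s * 1)). s \<leftarrow> [1, - 1], t \<leftarrow> [1, - 1]] @
    [((s * - 1, s * 1), (0, t), (1, 0)). s \<leftarrow> [1, - 1], t \<leftarrow> [1, - 1]]"

lemma icosahedron_eq: "icosahedron = zvec ` set icosahedron_vertices"
  by (simp add: icosahedron_def icosahedron_vertices_def flip: phi_def) auto

text \<open>Antipodal pairs are set apart because their difference points to a vertex, which is not
  the direction of a mirror normal.\<close>

lemma icosahedron_differences: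
  "list_all (\<lambda>w. list_all (\<lambda>w'. w' = w \<or> w' = zscale (- 1, 0) w \<or>
      list_ex (\<lambda>m. zscale (zdot m m) (zdiff w w') = zscale (zdot (zdiff w w') m) m) icosahedron_normals)
    icosahedron_vertices) (take 3 icosahedron_vertices)"
  by code_simp

lemma icosahedron_normals_norm: "list_all (\<lambda>m. zdot m m = (4, 0)) icosahedron_normals"
  by code_simp

lemma icosahedron_normals_zdot:
  "list_all (\<lambda>m. list_all (\<lambda>m'. list_ex (\<lambda>p. zdot m m' = p)
     [(0, 0), (2, 0), (- 2, 0), (4, 0), (- 4, 0), (0, 2), (0, - 2), (- 2, 2), (2, - 2)])
   icosahedron_normals) icosahedron_normals"
  by code_simp

text \<open>After squaring, the exponent of 5 is even on one side and odd on the other.\<close>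

lemma sqrt_5_irrational:
  fixes p q :: int
  assumes "of_int p = of_int q * sqrt 5"
  shows "q = 0"
proof (rule ccontr)
  assume q: "q \<noteq> 0"
  have "(of_int p)\<^sup>2 = (of_int q)\<^sup>2 * (5 :: real)" using assms by (simp add: power_mult_distrib)
  then have eq: "p\<^sup>2 = q\<^sup>2 * 5" by (metis of_int_eq_iff of_int_mult of_int_numeral of_int_power)
  then have p: "p \<noteq> 0" using q by auto
  have five: "prime_elem (5 :: int)" by (rule prime_imp_prime_elem) simp
  have "multiplicity 5 (p\<^sup>2) = 2 * multiplicity 5 p"
    using p five by (simp add: prime_elem_multiplicity_power_distrib)
  moreover have "multiplicity 5 (q\<^sup>2 * 5) = 2 * multiplicity 5 q + 1"
    using q five by (simp add: prime_elem_multiplicity_power_distrib prime_elem_multiplicity_mult_distrib)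
  ultimately have "2 * multiplicity 5 p = 2 * multiplicity 5 q + 1" using eq by simp
  then show False by presburger
qed

text \<open>Twice the number is \<open>c + b * sqrt 5\<close> with integers \<open>c\<close> and
  \<open>b\<close>, and its square would be 128. The irrational part \<open>2 * c * b\<close> must
  vanish, and neither \<open>5 * b\<^sup>2\<close> nor \<open>c\<^sup>2\<close> can be 128.\<close>

lemma zreal_square_neq_32: "(zreal p)\<^sup>2 \<noteq> 32"
proof
  assume sq: "(zreal p)\<^sup>2 = 32"
  obtain a b where p: "p = (a, b)" by fastforce
  define c where "c = 2 * a + b"
  have "2 * zreal p = of_int c + of_int b * sqrt 5" by (simp add: p c_def phi_def field_simps)
  then have "(of_int c + of_int b * sqrt 5)\<^sup>2 = (2 * zreal p)\<^sup>2" by simp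
  also have "\<dots> = 128" using sq by (simp add: power_mult_distrib)
  finally have "of_int (128 - c\<^sup>2 - 5 * b\<^sup>2) = of_int (2 * c * b) * sqrt 5"
    by (simp add: power2_sum power_mult_distrib)
  from sqrt_5_irrational[OF this] this have "c = 0 \<or> b = 0" "128 - c\<^sup>2 - 5 * b\<^sup>2 = 0"
    by (simp, metis mult_zero_left of_int_0 of_int_eq_0_iff)
  then consider "5 * b\<^sup>2 = 128" | "c\<^sup>2 = 128" by auto
  then show False
  proof cases
    case 1
    then have "(5 :: int) dvd 128" by (metis dvd_triv_left)
    then show False by simp
  next
    case 2
    then have "\<bar>c\<bar>\<^sup>2 < 12\<^sup>2" "11\<^sup>2 < \<bar>c\<bar>\<^sup>2" by simp_all
    then have "\<bar>c\<bar> < 12 \<and> 11 < \<bar>c\<bar>"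
      by (meson power_less_imp_less_base abs_ge_zero zero_le_numeral)
    then show False by linarith
  qed
qed

text \<open>To apply \<open>icosahedron_differences\<close>, a vertex is needed that is neither
  fixed nor sent to its antipode. If the first three vertices gave none, the reflection would fix
  all of them, although they span the space, or two of them would be multiples of
  \<open>a\<close>.\<close>

lemma icosahedron_mirror:
  assumes V: "reflection a ` icosahedron = icosahedron" and "a \<noteq> 0"
  obtains m where "m \<in> set icosahedron_normals" "along a (zvec m)"
proof -
  have "\<exists>w\<in>set (take 3 icosahedron_vertices). reflection a (zvec w) \<noteq> zvec w \<and> reflection a (zvec w) \<noteq> - zvec w"
  proof (rule ccontr)
    assume "\<not> ?thesis"
    then have fix_or_neg: "reflection a (zvec w) = zvec w \<or> reflection a (zvec w) = - zvec w"
      if "w \<in> set (take 3 icosahedron_vertices)" for w using that by blast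
    have alt: "zvec w \<bullet> a = 0 \<or> (\<exists>k. zvec w = k *\<^sub>R a)" if "w \<in> set (take 3 icosahedron_vertices)" for w
      using fix_or_neg[OF that]
    proof
      assume "reflection a (zvec w) = zvec w"
      then show ?thesis using \<open>a \<noteq> 0\<close> by (simp add: reflection_def)
    next
      define k where "k = 2 * (zvec w \<bullet> a) / (a \<bullet> a)"
      assume "reflection a (zvec w) = - zvec w"
      then have "2 *\<^sub>R zvec w = k *\<^sub>R a"
        by (simp add: reflection_def k_def scaleR_2 algebra_simps)
      then have "(1 / 2) *\<^sub>R 2 *\<^sub>R zvec w = (1 / 2) *\<^sub>R k *\<^sub>R a" by simp
      then have "zvec w = (k / 2) *\<^sub>R a" by simp
      then show ?thesis by blast
    qed
    \<comment> \<open>A reflection cannot fix one and negate another of these vertices, since their inner products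
      do not vanish.\<close>
    define A B C where "A = zvec ((0, 0), (1, 0), (0, 1))" and "B = zvec ((1, 0), (0, 1), (0, 0))"
      and "C = zvec ((0, 1), (0, 0), (1, 0))"
    have alts: "A \<bullet> a = 0 \<or> (\<exists>k. A = k *\<^sub>R a)" "B \<bullet> a = 0 \<or> (\<exists>k. B = k *\<^sub>R a)" "C \<bullet> a = 0 \<or> (\<exists>k. C = k *\<^sub>R a)"
      unfolding A_def B_def C_def by (rule alt; simp add: icosahedron_vertices_def)+
    have inner: "A \<bullet> B = phi" "A \<bullet> C = phi" "A \<bullet> A = phi + 2" "B \<bullet> B = phi + 2"
      by (simp_all add: A_def B_def C_def inner_real3 phi_square)
    show False
    proof (cases "A \<bullet> a = 0")
      case True
      then have ABC: "A \<bullet> a = 0" "B \<bullet> a = 0" "C \<bullet> a = 0" using alts(2,3) inner phi_bounds by auto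
      then have 1: "a $ 2 = - phi * a $ 3" "a $ 1 = - phi * a $ 2" "a $ 3 = - phi * a $ 1"
        by (simp_all add: A_def B_def C_def inner_real3)
      \<comment> \<open>Going once around the cyclic equations multiplies the coordinate by minus
        the cube of \<open>phi\<close>.\<close>
      have "a $ 3 = phi * (phi * (- phi * a $ 3))" using 1 by (metis mult_minus_left minus_mult_minus)
      then have "(1 + phi * (phi * phi)) * a $ 3 = 0" by (simp add: algebra_simps)
      moreover have "1 + phi * (phi * phi) > 0" using phi_bounds by (intro add_pos_pos mult_pos_pos) auto
      ultimately have "a $ 3 = 0" by simp
      then have "a $ 2 = 0" using 1(1) by simp
      then have "a $ 1 = 0" using 1(2) by simp
      then have "a = 0" using \<open>a $ 2 = 0\<close> \<open>a $ 3 = 0\<close> by (simp add: vector3_eq_iff)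
      then show False using \<open>a \<noteq> 0\<close> by contradiction
    next
      case False
      then obtain k where k: "A = k *\<^sub>R a" using alts(1) by blast
      then have "B \<bullet> a \<noteq> 0" using inner phi_bounds by (auto simp: inner_commute)
      then obtain l where l: "B = l *\<^sub>R a" using alts(2) by blast
      \<comment> \<open>Equality in the Cauchy-Schwarz inequality, as both vectors are multiples of
        \<open>a\<close>.\<close>
      have "(A \<bullet> B) * (A \<bullet> B) = (A \<bullet> A) * (B \<bullet> B)" by (simp add: k l)
      then have "phi * phi = (phi + 2) * (phi + 2)" by (simp only: inner)
      then show False using phi_bounds by (simp add: algebra_simps)
    qed
  qed
  then obtain w where w: "w \<in> set (take 3 icosahedron_vertices)" "reflection a (zvec w) \<noteq> zvec w"
    "reflection a (zvec w) \<noteq> - zvec w" by blast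
  then have "reflection a (zvec w) \<in> icosahedron"
    using V icosahedron_eq in_set_takeD by (metis image_eqI)
  then obtain w' where w': "w' \<in> set icosahedron_vertices" "reflection a (zvec w) = zvec w'"
    by (auto simp: icosahedron_eq)
  have "zvec (zscale (- 1, 0) w) = - zvec w" by (simp add: zvec_scale)
  then have "w' \<noteq> w" "w' \<noteq> zscale (- 1, 0) w" using w w' by auto
  then obtain m where m: "m \<in> set icosahedron_normals"
    "zscale (zdot m m) (zdiff w w') = zscale (zdot (zdiff w w') m) m"
    using icosahedron_differences w(1) w'(1) unfolding list_all_iff list_ex_iff by blast
  have "along (zvec w - zvec w') (zvec m)"
    using arg_cong[OF m(2), of zvec] by (simp only: along_def zvec_scale zvec_diff[symmetric] zvec_inner)
  then show ?thesis using that[OF m(1)] along_difference[OF w(2)] w'(2) by simp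
qed

section \<open>Rotation orders\<close>

text \<open>The orthogonal end nodes of the path account for the order 2, so only two squared
  cosines remain to be identified in each type.\<close>

lemma path_shaped_rotation_orders:
  assumes r: "root_system \<Phi>" and irr: "irreducible_roots \<Phi>" and s: "simple_roots \<Phi> [\<alpha>, \<beta>, \<gamma>]"
  obtains a b c where "simple_roots \<Phi> [a, b, c]" "path_shaped a b c"
    "rotation_orders \<alpha> \<beta> \<gamma> = {#2, rotation_order a b, rotation_order b c#}"
proof -
  have nz: "\<alpha> \<noteq> 0" "\<beta> \<noteq> 0" "\<gamma> \<noteq> 0" using simple_roots_nonzero[OF s] by auto
  have two: "rotation_order a c = 2" if "path_shaped a b c" "a \<noteq> 0" "c \<noteq> 0" for a b c :: 'a
    using that by (intro rotation_order_eq) (simp_all add: path_shaped_def)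
  have s': "simple_roots \<Phi> [\<beta>, \<gamma>, \<alpha>]" "simple_roots \<Phi> [\<gamma>, \<alpha>, \<beta>]"
    by (auto intro!: simple_roots_perm[OF s])
  from irreducible_simple_roots_path_shaped[OF r irr s] show ?thesis
  proof (elim disjE)
    assume p: "path_shaped \<alpha> \<beta> \<gamma>"
    show ?thesis using two[OF p] nz
      by (intro that[OF s p]) (simp add: rotation_orders_def add_mset_commute)
  next
    assume p: "path_shaped \<beta> \<gamma> \<alpha>"
    show ?thesis using two[OF p] nz
      by (intro that[OF s'(1) p])
        (simp add: rotation_orders_def rotation_order_commute[of \<gamma> \<alpha>] rotation_order_commute[of \<beta> \<alpha>] add_mset_commute)
  next
    assume p: "path_shaped \<gamma> \<alpha> \<beta>"
    show ?thesis using two[OF p] nz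
      by (intro that[OF s'(2) p])
        (simp add: rotation_orders_def rotation_order_commute[of \<gamma> \<alpha>] rotation_order_commute[of \<gamma> \<beta>] add_mset_commute)
  qed
qed

lemma path_shaped_squares:
  assumes "path_shaped a b c"
  shows "1 / 4 \<le> (sgn a \<bullet> sgn b)\<^sup>2" "1 / 4 \<le> (sgn b \<bullet> sgn c)\<^sup>2" "(sgn a \<bullet> sgn b)\<^sup>2 + (sgn b \<bullet> sgn c)\<^sup>2 < 1"
proof -
  have "1 / 4 \<le> x\<^sup>2" if "x \<le> - 1 / 2" for x :: real
    using power_mono[of "1 / 2" "- x" 2] that by (simp add: power2_eq_square)
  then show "1 / 4 \<le> (sgn a \<bullet> sgn b)\<^sup>2" "1 / 4 \<le> (sgn b \<bullet> sgn c)\<^sup>2" "(sgn a \<bullet> sgn b)\<^sup>2 + (sgn b \<bullet> sgn c)\<^sup>2 < 1"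
    using assms by (auto simp: path_shaped_def)
qed

lemma simple_roots_subset: "simple_roots \<Phi> \<Delta> \<Longrightarrow> \<alpha> \<in> set \<Delta> \<Longrightarrow> \<alpha> \<in> \<Phi>"
  by (auto simp: simple_roots_def)

text \<open>The form \<open>real 3\<close> matches the hypothesis of
  \<open>rotation_order_eq\<close> as it is instantiated below.\<close>

lemma cos_squares: "(cos (pi / real 3))\<^sup>2 = 1 / 4" "(cos (pi / real 4))\<^sup>2 = 1 / 2" "(cos (pi / real 5))\<^sup>2 = phi\<^sup>2 / 4"
  by (simp_all add: cos_60 cos_45 cos_pi_5 power_divide)

lemma is_A3_rotation_orders:
  assumes "is_A3 \<Phi>" and s: "simple_roots \<Phi> [\<alpha>, \<beta>, \<gamma>]"
  shows "rotation_orders \<alpha> \<beta> \<gamma> = {#2, 3, 3#}"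
proof -
  obtain Q where r: "root_system \<Phi>" and irr: "irreducible_roots \<Phi>" and Q: "orthogonal_transformation Q"
    and g: "reflection_group \<Phi> = symmetry_group (Q ` tetrahedron)"
    using assms by (auto simp: is_A3_def irreducible_with_symmetry_of_def)
  obtain a b c where s': "simple_roots \<Phi> [a, b, c]" and p: "path_shaped a b c"
    and ro: "rotation_orders \<alpha> \<beta> \<gamma> = {#2, rotation_order a b, rotation_order b c#}"
    using path_shaped_rotation_orders[OF r irr s] .
  have nz: "a \<noteq> 0" "b \<noteq> 0" "c \<noteq> 0" using simple_roots_nonzero[OF s'] by auto
  have mirror: "\<exists>x m. \<rho> = Q x \<and> m \<in> edge_normals \<and> along x m" if "\<rho> \<in> \<Phi>" "\<rho> \<noteq> 0" for \<rho>
  proof -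
    obtain x where x: "\<rho> = Q x" "reflection x ` tetrahedron = tetrahedron" using reflection_group_root[OF Q g \<open>\<rho> \<in> \<Phi>\<close>] .
    have "x \<noteq> 0" using that x linear_0[OF orthogonal_transformation_linear[OF Q]] by auto
    then show ?thesis using tetrahedron_mirror[OF x(2)] x(1) by metis
  qed
  have "(sgn \<rho> \<bullet> sgn \<sigma>)\<^sup>2 \<in> {0, 1 / 4, 1}" if in\<Delta>: "\<rho> \<in> set [a, b, c]" "\<sigma> \<in> set [a, b, c]" for \<rho> \<sigma>
  proof -
    have nz: "\<rho> \<noteq> 0" "\<sigma> \<noteq> 0" using simple_roots_nonzero[OF s'] in\<Delta> by auto
    have "\<rho> \<in> \<Phi>" "\<sigma> \<in> \<Phi>" using simple_roots_subset[OF s'] in\<Delta> by auto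
    obtain x m where x: "\<rho> = Q x" "m \<in> edge_normals" "along x m"
      using mirror[OF \<open>\<rho> \<in> \<Phi>\<close> nz(1)] by blast
    obtain y m' where y: "\<sigma> = Q y" "m' \<in> edge_normals" "along y m'"
      using mirror[OF \<open>\<sigma> \<in> \<Phi>\<close> nz(2)] by blast
    have mm: "m \<bullet> m = 2" "m' \<bullet> m' = 2" "(m \<bullet> m')\<^sup>2 \<in> {0, 1, 4}"
      using edge_normals_inner x(2) y(2) by blast+
    then have "m \<noteq> 0" "m' \<noteq> 0" by auto
    then have "(sgn \<rho> \<bullet> sgn \<sigma>)\<^sup>2 = (m \<bullet> m')\<^sup>2 / 4"
      using sgn_inner_along[OF Q x(3) _ y(3)] nz x y mm by simp
    then show ?thesis using mm(3) by auto
  qed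
  then have "(sgn a \<bullet> sgn b)\<^sup>2 \<in> {0, 1 / 4, 1}" "(sgn b \<bullet> sgn c)\<^sup>2 \<in> {0, 1 / 4, 1}" by simp_all
  \<comment> \<open>The values 0 and 1 are excluded by the lower bound \<open>1 / 4\<close> and by
    the sum being less than 1.\<close>
  then have "(sgn a \<bullet> sgn b)\<^sup>2 = 1 / 4" "(sgn b \<bullet> sgn c)\<^sup>2 = 1 / 4"
    using path_shaped_squares[OF p] by auto
  then have "rotation_order a b = 3" "rotation_order b c = 3"
    using nz by (auto intro!: rotation_order_eq simp only: cos_squares)
  then show ?thesis using ro by simp
qed

lemma is_B3_rotation_orders:
  assumes "is_B3 \<Phi>" and s: "simple_roots \<Phi> [\<alpha>, \<beta>, \<gamma>]"
  shows "rotation_orders \<alpha> \<beta> \<gamma> = {#2, 3, 4#}"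
proof -
  obtain Q where r: "root_system \<Phi>" and irr: "irreducible_roots \<Phi>" and Q: "orthogonal_transformation Q"
    and g: "reflection_group \<Phi> = symmetry_group (Q ` octahedron)"
    using assms by (auto simp: is_B3_def irreducible_with_symmetry_of_def)
  obtain a b c where s': "simple_roots \<Phi> [a, b, c]" and p: "path_shaped a b c"
    and ro: "rotation_orders \<alpha> \<beta> \<gamma> = {#2, rotation_order a b, rotation_order b c#}"
    using path_shaped_rotation_orders[OF r irr s] .
  have zero: "0 \<notin> \<Phi>" using r by (simp add: root_system_def)
  have nz: "a \<noteq> 0" "b \<noteq> 0" "c \<noteq> 0" using simple_roots_nonzero[OF s'] by auto
  have in\<Phi>: "a \<in> \<Phi>" "b \<in> \<Phi>" "c \<in> \<Phi>" using simple_roots_subset[OF s'] by auto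
  have mirror: "\<exists>x m. \<rho> = Q x \<and> m \<in> edge_normals \<union> axis_normals \<and> along x m" if "\<rho> \<in> \<Phi>" for \<rho>
  proof -
    obtain x where x: "\<rho> = Q x" "reflection x ` octahedron = octahedron" using reflection_group_root[OF Q g \<open>\<rho> \<in> \<Phi>\<close>] .
    have "x \<noteq> 0" using that x zero linear_0[OF orthogonal_transformation_linear[OF Q]] by auto
    then show ?thesis using octahedron_mirror[OF x(2)] x(1) by metis
  qed
  have norms: "m \<in> edge_normals \<Longrightarrow> m \<bullet> m = 2" "m \<in> axis_normals \<Longrightarrow> m \<bullet> m = 1" for m
    using edge_normals_inner(1) axis_normals_inner(1) by blast+
  have nonzero: "m \<noteq> 0" if "m \<in> edge_normals \<union> axis_normals" for m
    using that norms by force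
  have angle: "(sgn (Q x) \<bullet> sgn (Q y))\<^sup>2 = (m \<bullet> m')\<^sup>2 / ((m \<bullet> m) * (m' \<bullet> m'))"
    if "Q x \<in> \<Phi>" "Q y \<in> \<Phi>" "m \<in> edge_normals \<union> axis_normals" "along x m"
      "m' \<in> edge_normals \<union> axis_normals" "along y m'" for x y m m'
  proof -
    have "Q x \<noteq> 0" "Q y \<noteq> 0" using zero that(1,2) by auto
    then show ?thesis
      using sgn_inner_along[OF Q that(4) _ that(6) _ nonzero[OF that(3)] nonzero[OF that(5)]] by blast
  qed
  have edge_edge: "(sgn (Q x) \<bullet> sgn (Q y))\<^sup>2 \<in> {0, 1 / 4, 1}"
    if "Q x \<in> \<Phi>" "Q y \<in> \<Phi>" "m \<in> edge_normals" "along x m" "m' \<in> edge_normals" "along y m'" for x y m m'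
    using angle[OF that(1,2) _ that(4) _ that(6)] edge_normals_inner(2)[OF that(3,5)] that norms by auto
  have axis_edge: "(sgn (Q x) \<bullet> sgn (Q y))\<^sup>2 \<in> {0, 1 / 2}"
    if "Q x \<in> \<Phi>" "Q y \<in> \<Phi>" "m \<in> axis_normals" "along x m" "m' \<in> edge_normals" "along y m'" for x y m m'
    using angle[OF that(1,2) _ that(4) _ that(6)] axis_normals_inner(3)[OF that(3,5)] that norms by auto
  have axis_axis: "(sgn (Q x) \<bullet> sgn (Q y))\<^sup>2 \<in> {0, 1}"
    if "Q x \<in> \<Phi>" "Q y \<in> \<Phi>" "m \<in> axis_normals" "along x m" "m' \<in> axis_normals" "along y m'" for x y m m'
    using angle[OF that(1,2) _ that(4) _ that(6)] axis_normals_inner(2)[OF that(3,5)] that norms by auto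
  \<comment> \<open>The value \<open>1 / 4\<close> arises only between two edge normals. Hence
    simple roots of type \<open>A\<^sub>3\<close> would all lie along edge normals, at squared
    cosine 0 or \<open>1 / 2\<close> to any root along an axis.\<close>
  have quarter: "(sgn \<rho> \<bullet> sgn \<sigma>)\<^sup>2 \<in> {0, 1 / 4, 1 / 2, 1} \<and>
      ((sgn \<rho> \<bullet> sgn \<sigma>)\<^sup>2 = 1 / 4 \<longrightarrow> (\<exists>x m. \<rho> = Q x \<and> m \<in> edge_normals \<and> along x m))"
    if in\<Phi>: "\<rho> \<in> \<Phi>" "\<sigma> \<in> \<Phi>" for \<rho> \<sigma>
  proof -
    obtain x m where x: "\<rho> = Q x" "m \<in> edge_normals \<union> axis_normals" "along x m" using mirror[OF in\<Phi>(1)] by blast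
    obtain y m' where y: "\<sigma> = Q y" "m' \<in> edge_normals \<union> axis_normals" "along y m'" using mirror[OF in\<Phi>(2)] by blast
    note in\<Phi>' = in\<Phi>[unfolded x(1) y(1)]
    consider "m \<in> edge_normals" "m' \<in> edge_normals" | "m \<in> edge_normals" "m' \<in> axis_normals"
      | "m \<in> axis_normals" "m' \<in> edge_normals" | "m \<in> axis_normals" "m' \<in> axis_normals"
      using x(2) y(2) by blast
    then show ?thesis
    proof cases
      case 1
      then have "(sgn \<rho> \<bullet> sgn \<sigma>)\<^sup>2 \<in> {0, 1 / 4, 1}"
        using edge_edge[OF in\<Phi>' _ x(3) _ y(3)] unfolding x(1) y(1) by blast
      then show ?thesis using 1 x by blast
    next
      case 2
      then have "(sgn \<sigma> \<bullet> sgn \<rho>)\<^sup>2 \<in> {0, 1 / 2}"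
        using axis_edge[OF in\<Phi>'(2,1) _ y(3) _ x(3)] unfolding x(1) y(1) by blast
      then show ?thesis by (auto simp: inner_commute)
    next
      case 3
      then have "(sgn \<rho> \<bullet> sgn \<sigma>)\<^sup>2 \<in> {0, 1 / 2}"
        using axis_edge[OF in\<Phi>' _ x(3) _ y(3)] unfolding x(1) y(1) by blast
      then show ?thesis by auto
    next
      case 4
      then have "(sgn \<rho> \<bullet> sgn \<sigma>)\<^sup>2 \<in> {0, 1}"
        using axis_axis[OF in\<Phi>' _ x(3) _ y(3)] unfolding x(1) y(1) by blast
      then show ?thesis by auto
    qed
  qed
  have not_A3: "\<not> ((sgn a \<bullet> sgn b)\<^sup>2 = 1 / 4 \<and> (sgn b \<bullet> sgn c)\<^sup>2 = 1 / 4)"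
  proof
    assume q: "(sgn a \<bullet> sgn b)\<^sup>2 = 1 / 4 \<and> (sgn b \<bullet> sgn c)\<^sup>2 = 1 / 4"
    then have "(sgn c \<bullet> sgn b)\<^sup>2 = 1 / 4" by (simp add: inner_commute)
    then have edge: "\<exists>x m. \<delta> = Q x \<and> m \<in> edge_normals \<and> along x m" if "\<delta> \<in> {a, b, c}" for \<delta>
      using that q quarter in\<Phi> by blast
    obtain x m where x: "Q x \<in> \<Phi>" "m \<in> axis_normals" "along x m"
      using octahedron_axis_root[OF Q g zero] .
    have "(sgn (Q x) \<bullet> sgn \<delta>)\<^sup>2 \<in> {0, 1 / 2}" if "\<delta> \<in> {a, b, c}" for \<delta>
      using edge[OF that] axis_edge[OF x(1) _ x(2,3)] that in\<Phi> by blast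
    moreover have "t = - 1 / 2" if "t\<^sup>2 = 1 / 4" "t \<le> - 1 / 2" for t :: real
    proof -
      have "t\<^sup>2 = (1 / 2)\<^sup>2" using that by (simp add: power2_eq_square)
      then have "t = 1 / 2 \<or> t = - (1 / 2)" by (simp only: power2_eq_iff)
      then show ?thesis using that by auto
    qed
    then have "sgn a \<bullet> sgn b = - 1 / 2" "sgn b \<bullet> sgn c = - 1 / 2" using q p by (auto simp: path_shaped_def)
    moreover have "sgn a \<bullet> sgn c = 0" using p by (simp add: path_shaped_def)
    ultimately show False using no_root_at_45_degrees_to_A3[OF r s' x(1)] by blast
  qed
  have "(sgn a \<bullet> sgn b)\<^sup>2 \<in> {0, 1 / 4, 1 / 2, 1}" "(sgn b \<bullet> sgn c)\<^sup>2 \<in> {0, 1 / 4, 1 / 2, 1}"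
    using quarter in\<Phi> by blast+
  then consider "(sgn a \<bullet> sgn b)\<^sup>2 = 1 / 4" "(sgn b \<bullet> sgn c)\<^sup>2 = 1 / 2"
    | "(sgn a \<bullet> sgn b)\<^sup>2 = 1 / 2" "(sgn b \<bullet> sgn c)\<^sup>2 = 1 / 4"
    using path_shaped_squares[OF p] not_A3 by auto
  then show ?thesis
  proof cases
    case 1
    then have "rotation_order a b = 3" "rotation_order b c = 4"
      using nz by (auto intro!: rotation_order_eq simp only: cos_squares)
    then show ?thesis using ro by simp
  next
    case 2
    then have "rotation_order a b = 4" "rotation_order b c = 3"
      using nz by (auto intro!: rotation_order_eq simp only: cos_squares)
    then show ?thesis using ro by (simp add: add_mset_commute)
  qed
qed

lemma is_H3_rotation_orders:
  assumes "is_H3 \<Phi>" and s: "simple_roots \<Phi> [\<alpha>, \<beta>, \<gamma>]"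
  shows "rotation_orders \<alpha> \<beta> \<gamma> = {#2, 3, 5#}"
proof -
  obtain Q where r: "root_system \<Phi>" and irr: "irreducible_roots \<Phi>" and Q: "orthogonal_transformation Q"
    and g: "reflection_group \<Phi> = symmetry_group (Q ` icosahedron)"
    using assms by (auto simp: is_H3_def irreducible_with_symmetry_of_def)
  obtain a b c where s': "simple_roots \<Phi> [a, b, c]" and p: "path_shaped a b c"
    and ro: "rotation_orders \<alpha> \<beta> \<gamma> = {#2, rotation_order a b, rotation_order b c#}"
    using path_shaped_rotation_orders[OF r irr s] .
  have nz: "a \<noteq> 0" "b \<noteq> 0" "c \<noteq> 0" using simple_roots_nonzero[OF s'] by auto
  have mirror: "\<exists>x m. \<rho> = Q x \<and> m \<in> set icosahedron_normals \<and> along x (zvec m)" if "\<rho> \<in> set [a, b, c]" for \<rho>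
  proof -
    have "\<rho> \<in> \<Phi>" "\<rho> \<noteq> 0" using that simple_roots_subset[OF s'] simple_roots_nonzero[OF s'] by auto
    obtain x where x: "\<rho> = Q x" "reflection x ` icosahedron = icosahedron" using reflection_group_root[OF Q g \<open>\<rho> \<in> \<Phi>\<close>] .
    have "x \<noteq> 0" using \<open>\<rho> \<noteq> 0\<close> x linear_0[OF orthogonal_transformation_linear[OF Q]] by auto
    then show ?thesis using icosahedron_mirror[OF x(2)] x(1) by metis
  qed
  obtain x m1 where x: "a = Q x" "m1 \<in> set icosahedron_normals" "along x (zvec m1)" using mirror[of a] by auto
  obtain y m2 where y: "b = Q y" "m2 \<in> set icosahedron_normals" "along y (zvec m2)" using mirror[of b] by auto
  obtain z m3 where z: "c = Q z" "m3 \<in> set icosahedron_normals" "along z (zvec m3)" using mirror[of c] by auto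
  have norm: "zvec m \<bullet> zvec m = 4" if "m \<in> set icosahedron_normals" for m
    using icosahedron_normals_norm that by (simp add: list_all_iff zvec_inner)
  have nonzero: "zvec m \<noteq> 0" if "m \<in> set icosahedron_normals" for m using norm[OF that] by auto
  have ab: "(sgn a \<bullet> sgn b)\<^sup>2 = (zvec m1 \<bullet> zvec m2)\<^sup>2 / 16"
    using sgn_inner_along[OF Q x(3) _ y(3)] nz x y nonzero norm by simp
  have bc: "(sgn b \<bullet> sgn c)\<^sup>2 = (zvec m2 \<bullet> zvec m3)\<^sup>2 / 16"
    using sgn_inner_along[OF Q y(3) _ z(3)] nz y z nonzero norm by simp
  have ac: "(sgn a \<bullet> sgn c)\<^sup>2 = (zvec m1 \<bullet> zvec m3)\<^sup>2 / 16"
    using sgn_inner_along[OF Q x(3) _ z(3)] nz x z nonzero norm by simp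
  have angle_values: "t\<^sup>2 / 16 \<in> {0, 1 / 4, 1, phi\<^sup>2 / 4, (phi - 1)\<^sup>2 / 4}"
    if t: "t = zvec m \<bullet> zvec m'" "m \<in> set icosahedron_normals" "m' \<in> set icosahedron_normals" for t m m'
  proof -
    have "zdot m m' \<in> {(0, 0), (2, 0), (- 2, 0), (4, 0), (- 4, 0), (0, 2), (0, - 2), (- 2, 2), (2, - 2)}"
      using icosahedron_normals_zdot that(2,3) unfolding list_all_iff list_ex_iff by fastforce
    then have "t \<in> {0, 2, - 2, 4, - 4, 2 * phi, - (2 * phi), 2 * (phi - 1), - (2 * (phi - 1))}"
      unfolding t(1) zvec_inner by (elim insertE emptyE) simp_all
    then have "t\<^sup>2 \<in> {0\<^sup>2, 2\<^sup>2, 4\<^sup>2, (2 * phi)\<^sup>2, (2 * (phi - 1))\<^sup>2}"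
      by (elim insertE emptyE) (simp_all only: power2_minus insert_iff simp_thms)
    then show ?thesis unfolding power_mult_distrib by (elim insertE emptyE) simp_all
  qed
  \<comment> \<open>This removes the smallest nonzero angle value; \<open>large\<close> prevents
    both squared cosines from being \<open>phi\<^sup>2 / 4\<close>, since their sum is less than
    1.\<close>
  have small: "(phi - 1)\<^sup>2 / 4 < 1 / 4"
    using power_strict_mono[of "phi - 1" 1 2] phi_bounds by simp
  have large: "phi\<^sup>2 / 4 > 1 / 2"
    using power_strict_mono[of "3 / 2" phi 2] phi_bounds by (simp add: power2_eq_square)
  have angles: "(sgn a \<bullet> sgn b)\<^sup>2 \<in> {1 / 4, phi\<^sup>2 / 4}" "(sgn b \<bullet> sgn c)\<^sup>2 \<in> {1 / 4, phi\<^sup>2 / 4}"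
    using angle_values[OF refl x(2) y(2)] angle_values[OF refl y(2) z(2)] path_shaped_squares[OF p] small
    unfolding ab bc by auto
  have not_A3: "\<not> ((sgn a \<bullet> sgn b)\<^sup>2 = 1 / 4 \<and> (sgn b \<bullet> sgn c)\<^sup>2 = 1 / 4)"
  proof
    assume "(sgn a \<bullet> sgn b)\<^sup>2 = 1 / 4 \<and> (sgn b \<bullet> sgn c)\<^sup>2 = 1 / 4"
    then have "(zvec m1 \<bullet> zvec m2)\<^sup>2 = 4" "(zvec m2 \<bullet> zvec m3)\<^sup>2 = 4" unfolding ab bc by auto
    moreover have "zvec m1 \<bullet> zvec m3 = 0" using ac p by (simp add: path_shaped_def)
    \<comment> \<open>The Gram determinant is \<open>4 * 4 * 4 - 4 * 4 - 4 * 4\<close>.\<close>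
    ultimately have "(zreal (zdet m1 m2 m3))\<^sup>2 = 32"
      unfolding zdet_square using norm x(2) y(2) z(2) by simp
    then show False using zreal_square_neq_32 by contradiction
  qed
  from angles not_A3 path_shaped_squares(3)[OF p] large
  consider "(sgn a \<bullet> sgn b)\<^sup>2 = 1 / 4" "(sgn b \<bullet> sgn c)\<^sup>2 = phi\<^sup>2 / 4"
    | "(sgn a \<bullet> sgn b)\<^sup>2 = phi\<^sup>2 / 4" "(sgn b \<bullet> sgn c)\<^sup>2 = 1 / 4"
    by auto
  then show ?thesis
  proof cases
    case 1
    then have "rotation_order a b = 3" "rotation_order b c = 5"
      using nz by (auto intro!: rotation_order_eq simp only: cos_squares)
    then show ?thesis using ro by simp
  next
    case 2
    then have "rotation_order a b = 5" "rotation_order b c = 3"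
      using nz by (auto intro!: rotation_order_eq simp only: cos_squares)
    then show ?thesis using ro by (simp add: add_mset_commute)
  qed
qed

section \<open>The dihedral families\<close>

lemma I2_simple_inner:
  "I2_simple1 \<bullet> I2_simple1 = 1" "I2_simple2 n \<bullet> I2_simple2 n = 1" "I2_simple1 \<bullet> I2_simple2 n = - cos (pi / real n)"
  by (simp_all add: I2_simple1_def I2_simple2_def inner_real2 axis_def flip: power2_eq_square)

text \<open>The cosine is \<open>- cos (pi / real n)\<close>, and the sign disappears in the
  square.\<close>

lemma I2_rotation_order: "n \<ge> 2 \<Longrightarrow> rotation_order I2_simple1 (I2_simple2 n) = n"
  using I2_simple_inner(1) I2_simple_inner(2,3)[of n]
  by (intro rotation_order_eq) (auto simp: sgn_div_norm norm_eq_sqrt_inner)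

lemma A1_I2_rotation_orders:
  assumes "n \<ge> 2"
  shows "rotation_orders (1::real, 0) (0, I2_simple1) (0, I2_simple2 n) = {#2, 2, n#}"
proof -
  have nz: "I2_simple1 \<noteq> 0" "I2_simple2 n \<noteq> 0" using I2_simple_inner(1) I2_simple_inner(2,3)[of n] by auto
  have "rotation_order (1::real, 0) (0, I2_simple1) = 2" "rotation_order (1::real, 0) (0, I2_simple2 n) = 2"
    using nz by (auto intro!: rotation_order_eq simp: sgn_inner_sgn_eq_0 zero_prod_def)
  moreover have "rotation_order (0::real, I2_simple1) (0, I2_simple2 n) = n"
    using assms nz I2_simple_inner(1) I2_simple_inner(2,3)[of n]
    by (intro rotation_order_eq) (auto simp: sgn_div_norm norm_eq_sqrt_inner zero_prod_def)
  ultimately show ?thesis by (simp add: rotation_orders_def)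
qed

theorem mainTheorem3:
  shows
    "(\<forall>n\<ge>2. rotation_order I2_simple1 (I2_simple2 n) = n \<and>
            diagram_iso (single_leg n) (Dynkin_A n)) \<and>
     (\<forall>n\<ge>2. rotation_orders (1::real, 0) (0, I2_simple1) (0, I2_simple2 n) = {#2, 2, n#} \<and>
            diagram_iso (T_diagram 2 2 n) (Dynkin_D (n + 2))) \<and>
     (\<forall>\<Phi> \<alpha> \<beta> \<gamma>. is_A3 \<Phi> \<and> simple_roots \<Phi> [\<alpha>, \<beta>, \<gamma>] \<longrightarrow> rotation_orders \<alpha> \<beta> \<gamma> = {#2, 3, 3#}) \<and>
     diagram_iso (T_diagram 2 3 3) (Dynkin_E 6) \<and>
     (\<forall>\<Phi> \<alpha> \<beta> \<gamma>. is_B3 \<Phi> \<and> simple_roots \<Phi> [\<alpha>, \<beta>, \<gamma>] \<longrightarrow> rotation_orders \<alpha> \<beta> \<gamma> = {#2, 3, 4#}) \<and>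
     diagram_iso (T_diagram 2 3 4) (Dynkin_E 7) \<and>
     (\<forall>\<Phi> \<alpha> \<beta> \<gamma>. is_H3 \<Phi> \<and> simple_roots \<Phi> [\<alpha>, \<beta>, \<gamma>] \<longrightarrow> rotation_orders \<alpha> \<beta> \<gamma> = {#2, 3, 5#}) \<and>
     diagram_iso (T_diagram 2 3 5) (Dynkin_E 8)"
  using I2_rotation_order single_leg_iso A1_I2_rotation_orders T_22n_iso
    is_A3_rotation_orders is_B3_rotation_orders is_H3_rotation_orders
    T_23r_iso[of 3] T_23r_iso[of 4] T_23r_iso[of 5]
  by (simp del: add_2_eq_Suc') blast

end
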